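(* Suppose the Min-Max product of two $n\times n$ matrices can be computed in $T(n)$ time. Then All-Pairs Shortest Paths in $n$-node directed unweighted graphs (\textsf{UnweightedAPSP}) can be solved in $O(T(n)\log n)$ time.
   Context: Min-Max product (\textsf{Min-Max}): given two $n\times n$ matrices $A,B$ (with integer entries, possibly $\infty$), compute $C$ with $C_{ij}=\min_k \max(A_{ik},B_{kj})$. \textsf{UnweightedAPSP}: given an $n$-node unweighted directed graph $G=(V,E)$, compute for each pair $u,v\in V$ the length of a shortest path from $u$ to $v$ (a value in $\{0,1,\dots,n-1\}\cup\{\infty\}$). Running times are measured in the word-RAM model with $O(\log n)$-bit words. *)

theory Defs
  imports
    "HOL-Library.Extended"
    "HOL-Library.Extended_Nat"
    "HOL-Library.Landau_Symbols"
    "HOL-Library.Log_Nat"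
    "Graph_Theory.Graph_Theory"
begin

section \<open>The word RAM\<close>

text \<open>
  A deterministic random access machine whose registers and memory cells hold
  \<open>w\<close>-bit words, represented as natural numbers below \<open>2 ^ w\<close>. Since addresses
  are themselves words, only the cells below \<open>2 ^ w\<close> can be accessed. A program is a
  finite list of instructions, so it mentions only finitely many registers.
\<close>

datatype binop = Add | Sub | Mul | Div | Mod | BitAnd | BitOr | BitXor | ShiftL | ShiftR

datatype instr =
    Const nat nat            \<comment> \<open>\<open>r := v\<close>\<close>
  | Op binop nat nat nat     \<comment> \<open>\<open>r := s \<circ> t\<close>\<close>
  | Load nat nat             \<comment> \<open>\<open>r := mem[s]\<close>\<close>
  | Store nat nat            \<comment> \<open>\<open>mem[r] := s\<close>\<close>
  | Jump nat                 \<comment> \<open>\<open>goto l\<close>\<close>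
  | JumpLess nat nat nat     \<comment> \<open>\<open>if r < s goto l\<close>, comparing unsigned words\<close>

type_synonym program = "instr list"

record config =
  pc :: nat
  regs :: "nat \<Rightarrow> nat"
  mem :: "nat \<Rightarrow> nat"

context
  includes bit_operations_syntax
begin

text \<open>
  All arithmetic is modulo \<open>2 ^ w\<close>. Division by zero follows the HOL conventions
  \<open>a div 0 = 0\<close> and \<open>a mod 0 = a\<close>.
\<close>

fun eval_binop :: "nat \<Rightarrow> binop \<Rightarrow> nat \<Rightarrow> nat \<Rightarrow> nat" where
  "eval_binop w Add a b = take_bit w (a + b)"
| "eval_binop w Sub a b = take_bit w (a + 2 ^ w - b)"
| "eval_binop w Mul a b = take_bit w (a * b)"
| "eval_binop w Div a b = take_bit w (a div b)"
| "eval_binop w Mod a b = take_bit w (a mod b)"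
| "eval_binop w BitAnd a b = take_bit w (a AND b)"
| "eval_binop w BitOr a b = take_bit w (a OR b)"
| "eval_binop w BitXor a b = take_bit w (a XOR b)"
| "eval_binop w ShiftL a b = take_bit w (push_bit b a)"
| "eval_binop w ShiftR a b = take_bit w (drop_bit b a)"

end

fun exec_instr :: "nat \<Rightarrow> instr \<Rightarrow> config \<Rightarrow> config" where
  "exec_instr w (Const r v) s =
     s\<lparr>pc := Suc (pc s), regs := (regs s)(r := take_bit w v)\<rparr>"
| "exec_instr w (Op f r a b) s =
     s\<lparr>pc := Suc (pc s), regs := (regs s)(r := eval_binop w f (regs s a) (regs s b))\<rparr>"
| "exec_instr w (Load r a) s =
     s\<lparr>pc := Suc (pc s), regs := (regs s)(r := mem s (regs s a))\<rparr>"
| "exec_instr w (Store r a) s =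
     s\<lparr>pc := Suc (pc s), mem := (mem s)(regs s r := regs s a)\<rparr>"
| "exec_instr w (Jump l) s = s\<lparr>pc := l\<rparr>"
| "exec_instr w (JumpLess a b l) s =
     s\<lparr>pc := (if regs s a < regs s b then l else Suc (pc s))\<rparr>"

definition halted :: "program \<Rightarrow> config \<Rightarrow> bool" where
  "halted P s \<longleftrightarrow> length P \<le> pc s"

definition step :: "nat \<Rightarrow> program \<Rightarrow> config \<Rightarrow> config" where
  "step w P s = (if halted P s then s else exec_instr w (P ! pc s) s)"

text \<open>Every executed instruction costs one unit of time.\<close>

definition halts_within :: "nat \<Rightarrow> program \<Rightarrow> real \<Rightarrow> config \<Rightarrow> (config \<Rightarrow> bool) \<Rightarrow> bool" where
  "halts_within w P \<tau> s Q \<longleftrightarrow>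
     (\<exists>t s'. real t \<le> \<tau> \<and> s' = (step w P ^^ t) s \<and> halted P s' \<and> Q s')"

text \<open>
  Words of \<open>c \<lceil>log (n + 2)\<rceil>\<close> bits, where the constant \<open>c\<close> may depend on the algorithm.
  For \<open>c \<ge> 3\<close> the three \<open>n \<times> n\<close> matrices below are addressable, and the
  numbers up to \<open>n\<close> are finite entries in the sense of \<open>valid_entry\<close>.
\<close>

definition word_length :: "nat \<Rightarrow> nat \<Rightarrow> nat" where
  "word_length c n = c * ceillog2 (n + 2)"

text \<open>
  The input matrices \<open>Xs\<close> are stored consecutively in row-major order from address 0 on,
  all other cells are 0. Register 0 holds \<open>n\<close>, all other registers hold 0.
\<close>

definition init_config :: "nat \<Rightarrow> (nat \<Rightarrow> nat \<Rightarrow> nat) list \<Rightarrow> config" where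
  "init_config n Xs =
     \<lparr>pc = 0,
      regs = (\<lambda>_. 0)(0 := n),
      mem = (\<lambda>a. if a < length Xs * (n * n)
                 then (Xs ! (a div (n * n))) (a div n mod n) (a mod n) else 0)\<rparr>"

definition matrix_at :: "nat \<Rightarrow> nat \<Rightarrow> (nat \<Rightarrow> nat \<Rightarrow> nat) \<Rightarrow> config \<Rightarrow> bool" where
  "matrix_at n b X s \<longleftrightarrow> (\<forall>i<n. \<forall>j<n. mem s (b + i * n + j) = X i j)"

section \<open>Min-Max product\<close>

text \<open>
  Entries are integers or \<open>\<infinity>\<close>. Integers are stored in two's complement, and
  the largest signed word is reserved for \<open>\<infinity>\<close>.
\<close>

definition valid_entry :: "nat \<Rightarrow> int extended \<Rightarrow> bool" where
  "valid_entry w x = (case x of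
      Fin a \<Rightarrow> - (2 ^ (w - 1)) \<le> a \<and> a < 2 ^ (w - 1) - 1
    | Pinf \<Rightarrow> True
    | Minf \<Rightarrow> False)"

definition encode_entry :: "nat \<Rightarrow> int extended \<Rightarrow> nat" where
  "encode_entry w x = (case x of
      Fin a \<Rightarrow> nat (take_bit w a)
    | Pinf \<Rightarrow> 2 ^ (w - 1) - 1
    | Minf \<Rightarrow> undefined)"

definition minmax_product ::
  "nat \<Rightarrow> (nat \<Rightarrow> nat \<Rightarrow> 'a::linorder) \<Rightarrow> (nat \<Rightarrow> nat \<Rightarrow> 'a) \<Rightarrow> nat \<Rightarrow> nat \<Rightarrow> 'a" where
  "minmax_product n A B i j = Min ((\<lambda>k. max (A i k) (B k j)) ` {..<n})"

definition minmax_computable_in_time :: "(nat \<Rightarrow> real) \<Rightarrow> bool" where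
  "minmax_computable_in_time T \<longleftrightarrow>
     (\<exists>c\<ge>3. \<exists>P. \<forall>n A B. let w = word_length c n in
        (\<forall>i<n. \<forall>j<n. valid_entry w (A i j) \<and> valid_entry w (B i j)) \<longrightarrow>
        halts_within w P (T n)
          (init_config n [\<lambda>i j. encode_entry w (A i j), \<lambda>i j. encode_entry w (B i j)])
          (matrix_at n (2 * n * n) (\<lambda>i j. encode_entry w (minmax_product n A B i j))))"

section \<open>All-pairs shortest paths in unweighted directed graphs\<close>

definition distance :: "'a pair_pre_digraph \<Rightarrow> 'a \<Rightarrow> 'a \<Rightarrow> enat" where
  "distance G u v = (INF p \<in> {p. pre_digraph.apath (with_proj G) u p v}. enat (length p))"

definition encode_distance :: "nat \<Rightarrow> enat \<Rightarrow> nat" where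
  "encode_distance w d = (case d of enat k \<Rightarrow> k | \<infinity> \<Rightarrow> 2 ^ (w - 1) - 1)"

text \<open>The graph has vertex set \<open>{..<n}\<close> and is given by its adjacency matrix.\<close>

definition unweighted_apsp_solvable_in_time :: "(nat \<Rightarrow> real) \<Rightarrow> bool" where
  "unweighted_apsp_solvable_in_time T \<longleftrightarrow>
     (\<exists>c\<ge>3. \<exists>P. \<forall>n G. let w = word_length c n in
        pair_fin_digraph G \<and> pverts G = {..<n} \<longrightarrow>
        halts_within w P (T n)
          (init_config n [\<lambda>u v. of_bool ((u, v) \<in> parcs G)])
          (matrix_at n (n * n) (\<lambda>u v. encode_distance w (distance G u v))))"

end

theory Submission
  imports Defs
begin

text \<open>
  Let \<open>F\<close> hold the distances that are at most \<open>m\<close>, and \<open>\<infinity>\<close> elsewhere. The Min-Max product of \<open>2 F\<close> and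
  \<open>2 F + 1\<close> is the matrix of all \<open>d + 1\<close> for distances \<open>d \<le> 2 m\<close>, because \<open>2 a\<close> and \<open>2 b + 1\<close> are never equal and
  so \<open>max (2 a) (2 b + 1) \<ge> a + b + 1\<close>, with equality at the middle of a shortest path. Starting from the
  adjacency matrix, \<open>\<lceil>log n\<rceil>\<close> products yield all distances. The other work per round is \<open>O (n\<^sup>2)\<close>, and
  \<open>T n \<ge> n\<^sup>2\<close> since a product whose entries are all nonzero has to be written to blank memory.

  On the word RAM the Min-Max program is simulated with constant overhead on a machine whose words are
  twice as long.
\<close>

section \<open>Distances\<close>

text \<open>A Min-Max product has no addition. The plain product of \<open>F\<close> with itself
  yields only half the distance, rounded up; the offset of one between the two factors is what
  recovers the lost parity.

  The given program is a black box. It is correct only at its own word length, places its matrices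
  at address 0 and expects all of its \<open>2 ^ w\<close> cells to be blank. There are at least
  \<open>(n + 2) ^ 3\<close> such cells, too many to clear in every round, and the touched cells are
  not known from outside. Hence the epoch tags: raising one register invalidates every old cell at
  once. Tags need room above the \<open>w\<close>-bit values. Since the epoch advances by
  \<open>2 ^ w\<close> per round and there are fewer than \<open>n\<close> rounds for
  \<open>n > 0\<close>, doubling the word length is ample.\<close>

context pair_fin_digraph
begin

lemma awalk_shorten_to_apath:
  assumes "awalk u p v"
  shows "\<exists>q. apath u q v \<and> length q \<le> length p"
  using assms
proof (induction rule: awalk_to_apath_induct)
  case (path p)
  then show ?case by (auto simp: apath_def)
next
  case (decomp p q r s)
  then have "p = q @ r @ s"
    by (auto elim!: awalk_cyc_decompE)
  with decomp.IH show ?case by fastforce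
qed

text \<open>\<open>distance\<close> minimizes over simple paths, which are not closed under
  concatenation. Walks are, and removing cycles never lengthens a walk, so bounds are restated for
  walks.\<close>

lemma distance_le_iff:
  "distance G u v \<le> enat k \<longleftrightarrow> (\<exists>p. awalk u p v \<and> length p \<le> k)"
proof
  assume le: "distance G u v \<le> enat k"
  let ?S = "(\<lambda>p. enat (length p)) ` {p. apath u p v}"
  have "?S \<noteq> {}"
  proof
    assume "?S = {}"
    then have "distance G u v = \<infinity>"
      unfolding distance_def by (simp only: Inf_empty top_enat_def)
    with le show False by simp
  qed
  then have "Inf ?S \<in> ?S"
    by (auto simp: Inf_enat_def intro: LeastI)
  then obtain p where "apath u p v" "distance G u v = enat (length p)"
    unfolding distance_def by auto
  with le show "\<exists>p. awalk u p v \<and> length p \<le> k"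
    by (auto simp: apath_def)
next
  assume "\<exists>p. awalk u p v \<and> length p \<le> k"
  then obtain q where "apath u q v" "length q \<le> k"
    using awalk_shorten_to_apath le_trans by blast
  then show "distance G u v \<le> enat k"
    unfolding distance_def by (intro INF_lower2[of q]) auto
qed

lemma distance_triangle: "distance G u v \<le> distance G u x + distance G x v"
proof (cases "distance G u x"; cases "distance G x v")
  fix a b
  assume a: "distance G u x = enat a" and b: "distance G x v = enat b"
  obtain p where p: "awalk u p x" "length p \<le> a"
    using distance_le_iff[of u x a] a by auto
  obtain q where q: "awalk x q v" "length q \<le> b"
    using distance_le_iff[of x v b] b by auto
  have "awalk u (p @ q) v"
    using p q by (blast intro: awalk_appendI)
  then have "distance G u v \<le> enat (a + b)"
    using p q unfolding distance_le_iff by (intro exI[of _ "p @ q"]) auto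
  then show ?thesis by (simp add: a b)
qed auto

text \<open>Cut a walk after \<open>a\<close> arcs. If it is shorter than that, the second piece is
  empty and \<open>x\<close> is \<open>v\<close>.\<close>

lemma distance_split:
  assumes "distance G u v \<le> enat (a + b)"
  shows "\<exists>x \<in> pverts G. distance G u x \<le> enat a \<and> distance G x v \<le> enat b"
proof -
  obtain p where p: "awalk u p v" "length p \<le> a + b"
    using assms unfolding distance_le_iff by blast
  define x where "x = awlast u (take a p)"
  have "awalk u (take a p @ drop a p) v" using p by simp
  then have "awalk u (take a p) x" "awalk x (drop a p) v"
    unfolding awalk_append_iff x_def by auto
  moreover have "length (take a p) \<le> a" "length (drop a p) \<le> b"
    using p(2) by auto
  ultimately show ?thesis
    unfolding distance_le_iff using awalk_last_in_verts by blast
qed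

text \<open>A simple path visits each vertex at most once. This keeps finite matrix entries far
  below the code of infinity.\<close>

lemma distance_less_card:
  assumes "distance G u v = enat k"
  shows "k < card (pverts G)"
proof -
  obtain p where "awalk u p v" "length p \<le> k"
    using assms distance_le_iff[of u v k] by auto
  then obtain q where q: "apath u q v"
    using awalk_shorten_to_apath by blast
  then have "distance G u v \<le> enat (length q)"
    unfolding distance_le_iff by (auto simp: apath_def)
  with assms have "k \<le> length q" by simp
  also have "\<dots> < card (pverts G)"
    by (rule length_apath_less[OF q])
  finally show ?thesis .
qed

lemma distance_eq_0_iff:
  assumes "u \<in> pverts G"
  shows "distance G u v = 0 \<longleftrightarrow> u = v"
  using distance_le_iff[of u v 0] assms
  by (auto simp: awalk_Nil_iff zero_enat_def[symmetric])

lemma distance_le_1_iff: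
  assumes "u \<in> pverts G"
  shows "distance G u v \<le> enat 1 \<longleftrightarrow> u = v \<or> (u, v) \<in> parcs G"
proof -
  have "(\<exists>p. awalk u p v \<and> length p \<le> 1) \<longleftrightarrow> awalk u [] v \<or> (\<exists>e. awalk u [e] v)"
    by (auto simp: le_Suc_eq length_Suc_conv)
  also have "\<dots> \<longleftrightarrow> u = v \<or> (u, v) \<in> parcs G"
    using assms by (auto simp: awalk_simps dest: arc_snd_in_verts)
  finally show ?thesis
    by (simp add: distance_le_iff)
qed

end

section \<open>Structured programs\<close>

text \<open>Jump targets are absolute, so a program fragment is a function of its position.\<close>

type_synonym code = "nat \<Rightarrow> instr list"

text \<open>A timed total-correctness judgement for one initial state. Quantifying over
  \<open>pre\<close> and \<open>post\<close> makes it independent of the surrounding program;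
  control must leave through the end of the fragment.\<close>

definition runs :: "nat \<Rightarrow> code \<Rightarrow> (nat \<Rightarrow> nat) \<Rightarrow> (nat \<Rightarrow> nat) \<Rightarrow> nat \<Rightarrow>
    ((nat \<Rightarrow> nat) \<Rightarrow> (nat \<Rightarrow> nat) \<Rightarrow> bool) \<Rightarrow> bool" where
  "runs w C r m \<tau> Q \<longleftrightarrow> (\<forall>pre post. \<exists>t\<le>\<tau>. \<exists>r' m'.
     (step w (pre @ C (length pre) @ post) ^^ t) \<lparr>pc = length pre, regs = r, mem = m\<rparr> =
       \<lparr>pc = length pre + length (C (length pre)), regs = r', mem = m'\<rparr> \<and> Q r' m')"

definition seq_code :: "code \<Rightarrow> code \<Rightarrow> code" (infixr \<open>;;\<close> 60) where
  "C1 ;; C2 = (\<lambda>p. C1 p @ C2 (p + length (C1 p)))"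

definition while_code :: "nat \<Rightarrow> nat \<Rightarrow> code \<Rightarrow> code" where
  "while_code a b C = (\<lambda>p.
     [JumpLess a b (p + 2), Jump (p + 3 + length (C (p + 2)))] @ C (p + 2) @ [Jump p])"

fun straight :: "instr \<Rightarrow> bool" where
  "straight (Jump _) = False"
| "straight (JumpLess _ _ _) = False"
| "straight _ = True"

lemma runs_mono:
  assumes "runs w C r m \<tau> Q" "\<tau> \<le> \<tau>'" "\<And>r' m'. Q r' m' \<Longrightarrow> Q' r' m'"
  shows "runs w C r m \<tau>' Q'"
  using assms unfolding runs_def by (meson le_trans)

lemma runs_seq:
  assumes "runs w C1 r m \<tau>1 Q1" "\<And>r' m'. Q1 r' m' \<Longrightarrow> runs w C2 r' m' \<tau>2 Q"
  shows "runs w (C1 ;; C2) r m (\<tau>1 + \<tau>2) Q"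
  unfolding runs_def
proof (intro allI)
  fix pre post :: "instr list"
  let ?p = "length pre"
  let ?c1 = "C1 ?p"
  let ?c2 = "C2 (?p + length ?c1)"
  let ?P = "pre @ (C1 ;; C2) ?p @ post"
  have P1: "?P = pre @ ?c1 @ (?c2 @ post)" and P2: "?P = (pre @ ?c1) @ ?c2 @ post"
    by (simp_all add: seq_code_def)
  obtain t1 r1 m1 where 1: "t1 \<le> \<tau>1" "Q1 r1 m1"
    "(step w ?P ^^ t1) \<lparr>pc = ?p, regs = r, mem = m\<rparr> =
       \<lparr>pc = ?p + length ?c1, regs = r1, mem = m1\<rparr>"
    using assms(1) unfolding runs_def P1 by blast
  obtain t2 r2 m2 where 2: "t2 \<le> \<tau>2" "Q r2 m2"
    "(step w ?P ^^ t2) \<lparr>pc = length (pre @ ?c1), regs = r1, mem = m1\<rparr> =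
       \<lparr>pc = length (pre @ ?c1) + length ?c2, regs = r2, mem = m2\<rparr>"
    using assms(2)[OF 1(2)] unfolding runs_def P2
    by (metis length_append)
  have "(step w ?P ^^ (t2 + t1)) \<lparr>pc = ?p, regs = r, mem = m\<rparr> =
      \<lparr>pc = ?p + length ((C1 ;; C2) ?p), regs = r2, mem = m2\<rparr>"
    using 1(3) 2(3) by (simp add: funpow_add seq_code_def add.assoc)
  with 1 2 show "\<exists>t\<le>\<tau>1 + \<tau>2. \<exists>r' m'. (step w ?P ^^ t) \<lparr>pc = ?p, regs = r, mem = m\<rparr> =
      \<lparr>pc = ?p + length ((C1 ;; C2) ?p), regs = r', mem = m'\<rparr> \<and> Q r' m'"
    by (intro exI[of _ "t2 + t1"]) auto
qed

lemma step_at: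
  assumes "pc s = length pre"
  shows "step w (pre @ i # post) s = exec_instr w i s"
  using assms by (simp add: step_def halted_def nth_append)

lemma pc_exec_straight: "straight i \<Longrightarrow> pc (exec_instr w i s) = Suc (pc s)"
  by (cases i) auto

lemma steps_straight:
  assumes "list_all straight is" "pc s = length pre"
  shows "(step w (pre @ is @ post) ^^ length is) s = fold (exec_instr w) is s"
  using assms
proof (induction "is" arbitrary: pre s)
  case (Cons i is')
  have "(step w (pre @ (i # is') @ post) ^^ length (i # is')) s
      = (step w ((pre @ [i]) @ is' @ post) ^^ length is') (step w (pre @ i # is' @ post) s)"
    by (simp add: funpow_Suc_right del: funpow.simps)
  also have "step w (pre @ i # is' @ post) s = exec_instr w i s"
    by (rule step_at[OF Cons.prems(2)])
  also have "(step w ((pre @ [i]) @ is' @ post) ^^ length is') (exec_instr w i s)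
      = fold (exec_instr w) is' (exec_instr w i s)"
    using Cons.prems by (intro Cons.IH) (auto simp: pc_exec_straight)
  finally show ?case by simp
qed simp

text \<open>Straight-line instructions never inspect the program counter, so the effect may be
  computed from position 0, as \<open>runs_straight\<close> does.\<close>

lemma fold_exec_straight:
  assumes "list_all straight is"
  shows "\<exists>r' m'. \<forall>p. fold (exec_instr w) is \<lparr>pc = p, regs = r, mem = m\<rparr> =
           \<lparr>pc = p + length is, regs = r', mem = m'\<rparr>"
  using assms
proof (induction "is" arbitrary: r m)
  case (Cons i is')
  have "\<exists>r1 m1. \<forall>p. exec_instr w i \<lparr>pc = p, regs = r, mem = m\<rparr> = \<lparr>pc = Suc p, regs = r1, mem = m1\<rparr>"
    using Cons.prems by (cases i) auto
  then obtain r1 m1 where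
    "\<And>p. exec_instr w i \<lparr>pc = p, regs = r, mem = m\<rparr> = \<lparr>pc = Suc p, regs = r1, mem = m1\<rparr>"
    by blast
  moreover obtain r' m' where
    "\<And>p. fold (exec_instr w) is' \<lparr>pc = p, regs = r1, mem = m1\<rparr> =
       \<lparr>pc = p + length is', regs = r', mem = m'\<rparr>"
    using Cons.IH[of r1 m1] Cons.prems by auto
  ultimately show ?case by auto
qed simp

lemma runs_straight:
  assumes "list_all straight is"
    and "\<And>s. s = fold (exec_instr w) is \<lparr>pc = 0, regs = r, mem = m\<rparr> \<Longrightarrow> Q (regs s) (mem s)"
  shows "runs w (\<lambda>_. is) r m (length is) Q"
proof -
  obtain r' m' where f: "\<And>p. fold (exec_instr w) is \<lparr>pc = p, regs = r, mem = m\<rparr> =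
           \<lparr>pc = p + length is, regs = r', mem = m'\<rparr>"
    using fold_exec_straight[OF assms(1)] by blast
  have "Q r' m'" using assms(2) f[of 0] by simp
  then show ?thesis
    unfolding runs_def using steps_straight[OF assms(1)] f
    by (metis config.select_convs(1) order_refl)
qed

text \<open>The invariant is indexed by the number of finished iterations. Each iteration pays for
  the test and the jump back; the final 2 are the failing test and the exit jump.\<close>

lemma runs_while:
  assumes init: "I 0 r m"
    and body: "\<And>i r m. i < N \<Longrightarrow> I i r m \<Longrightarrow> r a < r b \<and> runs w C r m \<tau> (I (Suc i))"
    and exit: "\<And>r m. I N r m \<Longrightarrow> \<not> r a < r b"
  shows "runs w (while_code a b C) r m (N * (\<tau> + 2) + 2) (I N)"
  unfolding runs_def
proof (intro allI)
  fix pre post :: "instr list"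
  let ?p = "length pre"
  let ?c = "C (?p + 2)"
  let ?W = "while_code a b C ?p"
  let ?P = "pre @ ?W @ post"
  let ?i1 = "JumpLess a b (?p + 2)" and ?i2 = "Jump (?p + 3 + length ?c)"
  have P1: "?P = pre @ ?i1 # (?i2 # ?c @ Jump ?p # post)"
    and P2: "?P = (pre @ [?i1]) @ ?i2 # (?c @ Jump ?p # post)"
    and P3: "?P = (pre @ [?i1, ?i2]) @ ?c @ (Jump ?p # post)"
    and P4: "?P = (pre @ [?i1, ?i2] @ ?c) @ Jump ?p # post"
    by (simp_all add: while_code_def)
  have len: "length ?W = length ?c + 3" by (simp add: while_code_def)
  \<comment> \<open>Induction on the number \<open>j\<close> of iterations that remain.\<close>
  have "\<exists>t\<le>j * (\<tau> + 2) + 2. \<exists>r' m'. (step w ?P ^^ t) \<lparr>pc = ?p, regs = r, mem = m\<rparr> =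
      \<lparr>pc = ?p + length ?W, regs = r', mem = m'\<rparr> \<and> I N r' m'"
    if "j \<le> N" "I (N - j) r m" for j r m
    using that
  proof (induction j arbitrary: r m)
    case 0
    then have I: "I N r m" by simp
    have "step w ?P \<lparr>pc = ?p, regs = r, mem = m\<rparr> = \<lparr>pc = ?p + 1, regs = r, mem = m\<rparr>"
      unfolding P1 by (subst step_at) (simp_all add: exit[OF I])
    moreover have "step w ?P \<lparr>pc = ?p + 1, regs = r, mem = m\<rparr> =
        \<lparr>pc = ?p + length ?W, regs = r, mem = m\<rparr>"
      unfolding P2 len by (subst step_at) simp_all
    ultimately have "(step w ?P ^^ 2) \<lparr>pc = ?p, regs = r, mem = m\<rparr> =
        \<lparr>pc = ?p + length ?W, regs = r, mem = m\<rparr>"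
      by (simp add: numeral_2_eq_2)
    with I show ?case by (intro exI[of _ 2]) auto
  next
    case (Suc j)
    have less: "r a < r b" and run: "runs w C r m \<tau> (I (Suc (N - Suc j)))"
      using body[OF _ Suc.prems(2)] Suc.prems(1) by auto
    have s1: "step w ?P \<lparr>pc = ?p, regs = r, mem = m\<rparr> = \<lparr>pc = ?p + 2, regs = r, mem = m\<rparr>"
      unfolding P1 by (subst step_at) (simp_all add: less)
    obtain t1 r1 m1 where 1: "t1 \<le> \<tau>" "I (Suc (N - Suc j)) r1 m1"
      "(step w ?P ^^ t1) \<lparr>pc = ?p + 2, regs = r, mem = m\<rparr> =
        \<lparr>pc = ?p + 2 + length ?c, regs = r1, mem = m1\<rparr>"
    proof -
      have "\<exists>t\<le>\<tau>. \<exists>r' m'. (step w ?P ^^ t) \<lparr>pc = length (pre @ [?i1, ?i2]), regs = r, mem = m\<rparr> =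
        \<lparr>pc = length (pre @ [?i1, ?i2]) + length ?c, regs = r', mem = m'\<rparr> \<and> I (Suc (N - Suc j)) r' m'"
        using run[unfolded runs_def, rule_format, of "pre @ [?i1, ?i2]" "Jump ?p # post"]
        unfolding P3 by (simp add: add.commute)
      then show ?thesis using that by auto
    qed
    have s2: "step w ?P \<lparr>pc = ?p + 2 + length ?c, regs = r1, mem = m1\<rparr> =
        \<lparr>pc = ?p, regs = r1, mem = m1\<rparr>"
      unfolding P4 by (subst step_at) simp_all
    have "I (N - j) r1 m1"
      using 1(2) Suc.prems(1) by (simp add: Suc_diff_Suc)
    then obtain t2 r2 m2 where 2: "t2 \<le> j * (\<tau> + 2) + 2" "I N r2 m2"
      "(step w ?P ^^ t2) \<lparr>pc = ?p, regs = r1, mem = m1\<rparr> =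
        \<lparr>pc = ?p + length ?W, regs = r2, mem = m2\<rparr>"
      using Suc.IH[of r1 m1] Suc.prems(1) by auto
    have "(step w ?P ^^ (t2 + (1 + (t1 + 1)))) \<lparr>pc = ?p, regs = r, mem = m\<rparr> =
        \<lparr>pc = ?p + length ?W, regs = r2, mem = m2\<rparr>"
      by (simp only: funpow_add comp_def One_nat_def funpow.simps id_apply s1 1(3) s2 2(3))
    moreover have "t2 + (1 + (t1 + 1)) \<le> Suc j * (\<tau> + 2) + 2"
      using 1(1) 2(1) by simp
    ultimately show ?case using 2(2) by blast
  qed
  from this[of N r m] init
  show "\<exists>t\<le>N * (\<tau> + 2) + 2. \<exists>r' m'. (step w ?P ^^ t) \<lparr>pc = ?p, regs = r, mem = m\<rparr> =
      \<lparr>pc = ?p + length ?W, regs = r', mem = m'\<rparr> \<and> I N r' m'"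
    by simp
qed

section \<open>Simulating programs with shorter words\<close>

text \<open>
  Register \<open>r\<close> of the simulated \<open>w\<close>-bit program is register \<open>r + 16\<close> and its memory cell \<open>a\<close> is cell
  \<open>2 ^ w + a\<close>. Every run must start with blank memory, which takes too long to clear. So the value \<open>v\<close> is
  stored as \<open>v + E\<close>, where the epoch \<open>E\<close> is a multiple of \<open>2 ^ w\<close> that grows from run to run: for the
  contents \<open>x\<close> of a cell, \<open>x div E\<close> is 1 if the cell was written in the current epoch and 0 otherwise.
  Register 3 holds \<open>2 ^ w\<close>, register 4 holds \<open>E\<close>, and registers 5 and 6 are scratch. Blocks are padded
  to length 5, so that jump targets are easy to translate.
\<close>

definition decode_cell :: "nat \<Rightarrow> nat \<Rightarrow> nat \<Rightarrow> nat" where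
  "decode_cell w E x = x mod 2 ^ w * (x div E)"

text \<open>With \<open>2 ^ w \<le> E\<close>, the bound \<open>E + 2 ^ w\<close> on cells forces
  the quotient in \<open>decode_cell\<close> to be 0 or 1. \<open>R\<close> bounds the registers
  that the program mentions.\<close>

definition simulates :: "nat \<Rightarrow> nat \<Rightarrow> nat \<Rightarrow> (nat \<Rightarrow> nat) \<Rightarrow> (nat \<Rightarrow> nat) \<Rightarrow>
    (nat \<Rightarrow> nat) \<Rightarrow> (nat \<Rightarrow> nat) \<Rightarrow> bool" where
  "simulates w E R r m r' m' \<longleftrightarrow>
     (\<forall>a<R. r a < 2 ^ w \<and> r' (a + 16) = r a) \<and> r' 3 = 2 ^ w \<and> r' 4 = E \<and>
     (\<forall>a<2 ^ w. m a < 2 ^ w \<and> m' (2 ^ w + a) < E + 2 ^ w \<and> m a = decode_cell w E (m' (2 ^ w + a)))"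

definition preserved :: "nat \<Rightarrow> (nat \<Rightarrow> nat) \<Rightarrow> (nat \<Rightarrow> nat) \<Rightarrow> (nat \<Rightarrow> nat) \<Rightarrow> (nat \<Rightarrow> nat) \<Rightarrow> bool" where
  "preserved w r m r' m' \<longleftrightarrow>
     (\<forall>a<16. a \<noteq> 5 \<and> a \<noteq> 6 \<longrightarrow> r' a = r a) \<and> (\<forall>a<2 ^ w. m' a = m a)"

abbreviation nop :: instr where
  "nop \<equiv> Const 5 0"

text \<open>Results are computed on wide words and then reduced modulo register 3; literals too may
  exceed \<open>2 ^ w\<close>. \<open>Load\<close> forms the two factors of
  \<open>decode_cell\<close> in registers 6 and 5, and \<open>Store\<close> attaches the
  epoch.\<close>

fun compile_instr :: "(nat \<Rightarrow> nat) \<Rightarrow> instr \<Rightarrow> instr list" where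
  "compile_instr lab (Const r v) =
     [Const (r + 16) v, Op Mod (r + 16) (r + 16) 3, nop, nop, nop]"
| "compile_instr lab (Op f r a b) =
     [Op f (r + 16) (a + 16) (b + 16), Op Mod (r + 16) (r + 16) 3, nop, nop, nop]"
| "compile_instr lab (Load r a) =
     [Op Add 5 (a + 16) 3, Load 5 5, Op Mod 6 5 3, Op Div 5 5 4, Op Mul (r + 16) 6 5]"
| "compile_instr lab (Store r a) =
     [Op Add 5 (r + 16) 3, Op Add 6 (a + 16) 4, Store 5 6, nop, nop]"
| "compile_instr lab (Jump l) = [Jump (lab l), nop, nop, nop, nop]"
| "compile_instr lab (JumpLess a b l) = [JumpLess (a + 16) (b + 16) (lab l), nop, nop, nop, nop]"

text \<open>A jump anywhere past the end halts the original program. Clipping the target sends it to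
  the end of the fragment, where the enclosing code continues.\<close>

definition compile :: "program \<Rightarrow> code" where
  "compile P = (\<lambda>p. concat (map (compile_instr (\<lambda>l. p + 5 * min l (length P))) P))"

fun instr_regs :: "instr \<Rightarrow> nat set" where
  "instr_regs (Const r v) = {r}"
| "instr_regs (Op f r a b) = {r, a, b}"
| "instr_regs (Load r a) = {r, a}"
| "instr_regs (Store r a) = {r, a}"
| "instr_regs (Jump l) = {}"
| "instr_regs (JumpLess a b l) = {a, b}"

lemma length_compile_instr [simp]: "length (compile_instr lab i) = 5"
  by (cases i) auto

lemma length_concat_compile [simp]: "length (concat (map (compile_instr lab) P)) = 5 * length P"
  by (induction P) auto

lemma length_compile [simp]: "length (compile P p) = 5 * length P"
  by (simp add: compile_def)

text \<open>The simulated registers are zeroed before each run; as the program is fixed, this costs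
  only the constant \<open>R\<close>. Positivity of \<open>R\<close> includes register 0, which
  receives \<open>n\<close>.\<close>

lemma instr_regs_bound: "\<exists>R>0. \<forall>i\<in>set P. instr_regs i \<subseteq> {..<R}"
proof -
  have "finite (\<Union> (instr_regs ` set P))"
    by (auto intro!: finite_UN_I) (rename_tac i, case_tac i, auto)
  then obtain R where "\<Union> (instr_regs ` set P) \<subseteq> {..<R}"
    using finite_nat_iff_bounded by blast
  then show ?thesis
    by (intro exI[of _ "Suc R"]) fastforce
qed

text \<open>Apart from \<open>Sub\<close>, both widths truncate the same natural number. In
  \<open>Sub\<close> the summands \<open>2 ^ w'\<close> and \<open>2 ^ w\<close> differ by a
  multiple of \<open>2 ^ w\<close>, and \<open>b < 2 ^ w\<close> keeps the natural subtraction from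
  being cut off at 0.\<close>

lemma take_bit_eval_binop:
  assumes "w \<le> w'" "b < 2 ^ w"
  shows "take_bit w (eval_binop w' f a b) = eval_binop w f a b"
proof -
  have tt: "take_bit w (take_bit w' x) = take_bit w x" for x :: nat
    using assms(1) by simp
  show ?thesis
  proof (cases "f = Sub")
    case True
    obtain d where d: "(2::nat) ^ w' = 2 ^ w * d"
      using assms(1) by (metis le_imp_power_dvd dvd_def)
    have "0 < d" using d by (cases d) auto
    then obtain e where e: "d = Suc e" by (cases d) auto
    have "a + 2 ^ w' - b = (a + 2 ^ w - b) + 2 ^ w * e"
      unfolding d e using assms(2) by simp
    then have "take_bit w (a + 2 ^ w' - b) = take_bit w (a + 2 ^ w - b)"
      by (simp only: take_bit_eq_mod mod_mult_self2)
    then show ?thesis by (simp add: True tt del: take_bit_take_bit)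
  next
    case False
    then show ?thesis by (cases f) (simp_all add: tt del: take_bit_take_bit)
  qed
qed

text \<open>The epoch is a multiple of \<open>2 ^ w\<close>, so it vanishes modulo
  \<open>2 ^ w\<close>, and it exceeds \<open>v\<close>, so the quotient is 1.\<close>

lemma decode_cell_fresh:
  assumes "v < 2 ^ w" "0 < e"
  shows "decode_cell w (2 ^ w * e) (v + 2 ^ w * e) = v"
proof -
  have "v < 2 ^ w * e"
    using assms by (cases e) auto
  then have "(v + 2 ^ w * e) div (2 ^ w * e) = 1"
    using assms by (intro div_nat_eqI) auto
  with assms show ?thesis by (simp add: decode_cell_def)
qed

lemma decode_cell_stale: "x < E \<Longrightarrow> decode_cell w E x = 0"
  by (simp add: decode_cell_def)

text \<open>The assumption \<open>wide\<close> lets tagged values fit in a wide word. As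
  \<open>2 ^ w \<le> E\<close>, the shifted addresses fit as well.\<close>

locale simulation =
  fixes w w' e E R :: nat
  assumes e: "0 < e" and E: "E = 2 ^ w * e" and wide: "E + 2 ^ w \<le> 2 ^ w'"
begin

lemma w_le: "w \<le> w'"
proof -
  have "(2::nat) ^ w \<le> 2 ^ w'" using wide by linarith
  then show ?thesis by (rule power_le_imp_le_exp[rotated]) simp
qed

lemma E_ge: "2 ^ w \<le> E"
  using e unfolding E by (cases e) auto

lemma eval_small:
  assumes "(x::nat) < 2 ^ w'"
  shows "take_bit w' x = x"
  using assms by (simp add: take_bit_nat_eq_self)

lemma eval_mod: "eval_binop w' Mod x (2 ^ w) = take_bit w x"
  using w_le by (simp add: take_bit_eq_mod[symmetric] min_def)

lemma eval_binop_less: "eval_binop w f a b < 2 ^ w"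
  by (cases f) (simp_all only: eval_binop.simps take_bit_nat_less_exp)

lemma simulates_set_reg:
  assumes "simulates w E R r m r' m'" "v < 2 ^ w"
  shows "simulates w E R (r(d := v)) m (r'(d + 16 := v)) m'"
  using assms unfolding simulates_def by auto

lemma simulates_scratch:
  assumes "simulates w E R r m r' m'"
  shows "simulates w E R r m (r'(5 := v)) m'" "simulates w E R r m (r'(6 := v)) m'"
  using assms unfolding simulates_def by auto

lemma simulates_store:
  assumes "simulates w E R r m r' m'" "a < 2 ^ w" "v < 2 ^ w"
  shows "simulates w E R r (m(a := v)) r' (m'(a + 2 ^ w := v + E))"
proof -
  have "decode_cell w E (v + E) = v"
    unfolding E by (rule decode_cell_fresh) (use assms e in auto)
  with assms show ?thesis unfolding simulates_def by (auto simp: add.commute)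
qed

lemma preserved_set_reg:
  assumes "preserved w r0 m0 r' m'" "16 \<le> d \<or> d = 5 \<or> d = 6"
  shows "preserved w r0 m0 (r'(d := v)) m'"
  using assms unfolding preserved_def by auto

lemma preserved_store:
  assumes "preserved w r0 m0 r' m'"
  shows "preserved w r0 m0 r' (m'(a + 2 ^ w := v))"
  using assms unfolding preserved_def by auto

text \<open>\<open>r0\<close> and \<open>m0\<close> stand for the state at the start of the whole
  run, so the frame condition accumulates along it.\<close>

lemma simulates_straight:
  assumes sim: "simulates w E R r m r' m'" and pre: "preserved w r0 m0 r' m'"
    and i: "straight i" "instr_regs i \<subseteq> {..<R}"
    and s: "s = exec_instr w i \<lparr>pc = p, regs = r, mem = m\<rparr>"
    and s': "s' = fold (exec_instr w') (compile_instr lab i) \<lparr>pc = p', regs = r', mem = m'\<rparr>"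
  shows "simulates w E R (regs s) (mem s) (regs s') (mem s') \<and>
         preserved w r0 m0 (regs s') (mem s')"
proof -
  have r: "\<And>a. a < R \<Longrightarrow> r a < 2 ^ w" "\<And>a. a < R \<Longrightarrow> r' (a + 16) = r a"
    and r3: "r' 3 = 2 ^ w" and r4: "r' 4 = E"
    and m: "\<And>a. a < 2 ^ w \<Longrightarrow> m a < 2 ^ w"
      "\<And>a. a < 2 ^ w \<Longrightarrow> m' (2 ^ w + a) < E + 2 ^ w"
      "\<And>a. a < 2 ^ w \<Longrightarrow> m a = decode_cell w E (m' (2 ^ w + a))"
    using sim unfolding simulates_def by auto
  have add: "eval_binop w' Add (r a) (2 ^ w) = r a + 2 ^ w"
    "eval_binop w' Add (r a) E = r a + E" if "a < R" for a
    using r(1)[OF that] E_ge wide by (simp_all add: eval_small)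
  show ?thesis
  proof (cases i)
    case (Const d v)
    have "take_bit w' (take_bit w' v mod 2 ^ w) = take_bit w v"
      using w_le by (simp add: take_bit_eq_mod[symmetric])
    then have s': "regs s' = r'(d + 16 := take_bit w' v, d + 16 := take_bit w v, 5 := 0, 5 := 0, 5 := 0)"
      "mem s' = m'"
      unfolding s' Const by (simp_all add: r3)
    have s: "regs s = r(d := take_bit w v)" "mem s = m" by (simp_all add: s Const)
    show ?thesis
      unfolding s' s fun_upd_upd
      by (intro conjI simulates_scratch simulates_set_reg preserved_set_reg sim pre) auto
  next
    case (Op f d a b)
    have "eval_binop w' Mod (eval_binop w' f (r a) (r b)) (2 ^ w) = eval_binop w f (r a) (r b)"
      unfolding eval_mod using r(1) i(2) by (intro take_bit_eval_binop w_le) (auto simp: Op)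
    then have s': "regs s' = r'(d + 16 := eval_binop w' f (r a) (r b), d + 16 := eval_binop w f (r a) (r b),
        5 := 0, 5 := 0, 5 := 0)" "mem s' = m'"
      using i(2) unfolding s' Op by (simp_all add: r r3 del: eval_binop.simps)
    have s: "regs s = r(d := eval_binop w f (r a) (r b))" "mem s = m" by (simp_all add: s Op)
    show ?thesis
      unfolding s' s fun_upd_upd
      by (intro conjI simulates_scratch simulates_set_reg preserved_set_reg sim pre eval_binop_less) auto
  next
    case (Load d a)
    let ?x = "m' (2 ^ w + r a)"
    have a: "a < R" "r a < 2 ^ w" using i(2) r(1) by (auto simp: Load)
    have x: "?x < E + 2 ^ w" by (rule m(2)[OF a(2)])
    have "?x mod 2 ^ w < 2 ^ w'"
      by (rule le_less_trans[OF mod_less_eq_dividend]) (use x wide in simp)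
    moreover have "?x div E < 2 ^ w'"
      by (rule le_less_trans[OF div_le_dividend]) (use x wide in simp)
    \<comment> \<open>This product is the simulated cell \<open>m (r a)\<close>, hence below
      \<open>2 ^ w\<close>.\<close>
    moreover have "?x mod 2 ^ w * (?x div E) < 2 ^ w'"
      using m(1)[OF a(2)] E_ge wide unfolding m(3)[OF a(2)] decode_cell_def by linarith
    ultimately have dec: "eval_binop w' Mul (eval_binop w' Mod ?x (2 ^ w)) (eval_binop w' Div ?x E) = m (r a)"
      using m(3)[OF a(2)] by (simp add: eval_small decode_cell_def)
    have s': "regs s' = r'(5 := r a + 2 ^ w, 5 := ?x, 6 := eval_binop w' Mod ?x (2 ^ w),
        5 := eval_binop w' Div ?x E, d + 16 := m (r a))" "mem s' = m'"
      using dec a unfolding s' Load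
      by (simp_all add: r(2) r3 r4 add add.commute[of "r a"] del: eval_binop.simps)
    have s: "regs s = r(d := m (r a))" "mem s = m" by (simp_all add: s Load)
    show ?thesis
      unfolding s' s
      by (intro conjI simulates_scratch simulates_set_reg preserved_set_reg sim pre m(1) a) auto
  next
    case (Store a d)
    have a: "a < R" "r a < 2 ^ w" "d < R" "r d < 2 ^ w" using i(2) r(1) by (auto simp: Store)
    have s': "regs s' = r'(5 := r a + 2 ^ w, 6 := r d + E, 5 := 0, 5 := 0)" "mem s' = m'(r a + 2 ^ w := r d + E)"
      using a unfolding s' Store by (simp_all add: r(2) r3 r4 add del: eval_binop.simps)
    have s: "regs s = r" "mem s = m(r a := r d)" by (simp_all add: s Store)
    show ?thesis
      unfolding s' s
      by (intro conjI simulates_scratch simulates_store preserved_set_reg preserved_store sim pre a) auto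
  qed (use i in auto)
qed


text \<open>A step-by-step simulation in which one narrow step costs at most five wide ones. The two
  program counters are related by the label map that \<open>compile\<close> uses for jump
  targets.\<close>

lemma runs_compile:
  assumes R: "\<forall>i\<in>set P. instr_regs i \<subseteq> {..<R}"
    and sim: "simulates w E R r m r' m'"
    and halt: "halted P ((step w P ^^ t) \<lparr>pc = 0, regs = r, mem = m\<rparr>)"
  shows "runs w' (compile P) r' m' (5 * t) (\<lambda>r'' m''.
    let s = (step w P ^^ t) \<lparr>pc = 0, regs = r, mem = m\<rparr>
    in simulates w E R (regs s) (mem s) r'' m'' \<and> preserved w r' m' r'' m'')"
  unfolding runs_def
proof (intro allI)
  fix pre post :: "instr list"
  let ?p = "length pre"
  let ?lab = "\<lambda>l. ?p + 5 * min l (length P)"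
  let ?Q = "pre @ compile P ?p @ post"
  have main: "\<exists>u\<le>5 * t. \<exists>r2 m2. (step w' ?Q ^^ u) \<lparr>pc = ?lab p, regs = r1', mem = m1'\<rparr> =
       \<lparr>pc = ?p + 5 * length P, regs = r2, mem = m2\<rparr> \<and>
       (let s = (step w P ^^ t) \<lparr>pc = p, regs = r1, mem = m1\<rparr>
        in simulates w E R (regs s) (mem s) r2 m2 \<and> preserved w r' m' r2 m2)"
    if "simulates w E R r1 m1 r1' m1'" "preserved w r' m' r1' m1'"
      "halted P ((step w P ^^ t) \<lparr>pc = p, regs = r1, mem = m1\<rparr>)" for t p r1 m1 r1' m1'
    using that
  proof (induction t arbitrary: p r1 m1 r1' m1')
    case 0
    then show ?case by (intro exI[of _ 0]) (auto simp: halted_def min_def)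
  next
    case (Suc t)
    show ?case
    proof (cases "p < length P")
      \<comment> \<open>The narrow machine idles once it has halted; the wide one is already at the
        end of the fragment and takes no step.\<close>
      case False
      then have "step w P \<lparr>pc = p, regs = r1, mem = m1\<rparr> = \<lparr>pc = p, regs = r1, mem = m1\<rparr>"
        by (simp add: step_def halted_def)
      then have "(step w P ^^ Suc t) \<lparr>pc = p, regs = r1, mem = m1\<rparr> =
          (step w P ^^ t) \<lparr>pc = p, regs = r1, mem = m1\<rparr>"
        by (simp only: funpow_Suc_right comp_def)
      moreover have "u \<le> 5 * Suc t" if "u \<le> 5 * t" for u
        using that by simp
      ultimately show ?thesis
        using Suc.IH[OF Suc.prems(1,2), of p] Suc.prems(3) by metis
    next
      case True
      define i where "i = P ! p"
      have reg: "instr_regs i \<subseteq> {..<R}" using R True by (simp add: i_def)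
      define s where "s = exec_instr w i \<lparr>pc = p, regs = r1, mem = m1\<rparr>"
      have s: "step w P \<lparr>pc = p, regs = r1, mem = m1\<rparr> = s"
        using True by (simp add: step_def halted_def s_def i_def)
      have split: "P = take p P @ i # drop (Suc p) P"
        using True by (simp add: i_def id_take_nth_drop)
      obtain A B where Q: "?Q = A @ compile_instr ?lab i @ B" and pos: "length A = ?lab p"
      proof
        have "concat (map f P) = concat (map f (take p P)) @ f i @ concat (map f (drop (Suc p) P))"
          for f :: "instr \<Rightarrow> instr list"
          using arg_cong[OF split, of "\<lambda>P. concat (map f P)"]
          by (simp only: map_append list.map concat_append concat.simps)
        then show "?Q = (pre @ concat (map (compile_instr ?lab) (take p P))) @ compile_instr ?lab i @
            (concat (map (compile_instr ?lab) (drop (Suc p) P)) @ post)"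
          unfolding compile_def by simp
      qed (use True in simp)
      have "\<exists>u\<le>5. \<exists>r2 m2. (step w' ?Q ^^ u) \<lparr>pc = ?lab p, regs = r1', mem = m1'\<rparr> =
          \<lparr>pc = ?lab (pc s), regs = r2, mem = m2\<rparr> \<and>
          simulates w E R (regs s) (mem s) r2 m2 \<and> preserved w r' m' r2 m2"
      proof (cases "straight i")
        case True
        have st: "list_all straight (compile_instr ?lab i)"
          using True by (cases i) auto
        obtain r2 m2 where f: "\<And>q. fold (exec_instr w') (compile_instr ?lab i) \<lparr>pc = q, regs = r1', mem = m1'\<rparr> =
            \<lparr>pc = q + 5, regs = r2, mem = m2\<rparr>"
          using fold_exec_straight[OF st, of w' r1' m1'] by auto
        have "(step w' ?Q ^^ 5) \<lparr>pc = ?lab p, regs = r1', mem = m1'\<rparr> =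
            \<lparr>pc = ?lab p + 5, regs = r2, mem = m2\<rparr>"
          unfolding Q using steps_straight[OF st, of "\<lparr>pc = ?lab p, regs = r1', mem = m1'\<rparr>" A w' B] pos f by simp
        moreover have "pc s = Suc p"
          using True by (simp add: s_def pc_exec_straight)
        moreover have "simulates w E R (regs s) (mem s) r2 m2 \<and> preserved w r' m' r2 m2"
          using simulates_straight[OF Suc.prems(1,2) True reg s_def f[symmetric]] by simp
        ultimately show ?thesis
          using \<open>p < length P\<close> by (intro exI[of _ 5] exI[of _ r2] exI[of _ m2]) simp
      next
        case False
        then consider (jump) l where "i = Jump l" | (less) a b l where "i = JumpLess a b l"
          by (cases i) auto
        then show ?thesis
        proof cases
          case jump
          have "step w' ?Q \<lparr>pc = ?lab p, regs = r1', mem = m1'\<rparr> = \<lparr>pc = ?lab l, regs = r1', mem = m1'\<rparr>"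
            unfolding Q jump compile_instr.simps append_Cons by (subst step_at) (use pos in simp_all)
          then show ?thesis
            using Suc.prems(1,2) by (intro exI[of _ 1]) (auto simp: s_def jump)
        next
          case less
          have ab: "r1' (a + 16) = r1 a" "r1' (b + 16) = r1 b"
            using Suc.prems(1) reg by (auto simp: simulates_def less)
          have st: "step w' ?Q \<lparr>pc = ?lab p, regs = r1', mem = m1'\<rparr> =
              \<lparr>pc = if r1 a < r1 b then ?lab l else Suc (?lab p), regs = r1', mem = m1'\<rparr>"
            unfolding Q less compile_instr.simps append_Cons by (subst step_at) (use pos ab in simp_all)
          show ?thesis
          proof (cases "r1 a < r1 b")
            case True
            then show ?thesis
              using Suc.prems(1,2) st by (intro exI[of _ 1]) (auto simp: s_def less)
          next
            case False
            \<comment> \<open>When the test fails, control runs through the four padding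
              instructions, which only clear scratch register 5.\<close>
            have Q': "?Q = (A @ [JumpLess (a + 16) (b + 16) (?lab l)]) @ [nop, nop, nop, nop] @ B"
              unfolding Q less by simp
            have "(step w' ?Q ^^ length [nop, nop, nop, nop]) \<lparr>pc = Suc (?lab p), regs = r1', mem = m1'\<rparr> =
                fold (exec_instr w') [nop, nop, nop, nop] \<lparr>pc = Suc (?lab p), regs = r1', mem = m1'\<rparr>"
              unfolding Q' by (rule steps_straight) (use pos in simp_all)
            also have "\<dots> = \<lparr>pc = ?lab p + 5, regs = r1'(5 := 0), mem = m1'\<rparr>"
              by simp
            finally have "(step w' ?Q ^^ 4) \<lparr>pc = Suc (?lab p), regs = r1', mem = m1'\<rparr> =
                \<lparr>pc = ?lab p + 5, regs = r1'(5 := 0), mem = m1'\<rparr>"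
              by (simp add: numeral_eq_Suc)
            with st False have "(step w' ?Q ^^ (4 + 1)) \<lparr>pc = ?lab p, regs = r1', mem = m1'\<rparr> =
                \<lparr>pc = ?lab p + 5, regs = r1'(5 := 0), mem = m1'\<rparr>"
              by (simp only: funpow_add comp_def One_nat_def funpow.simps id_apply if_False)
            moreover have "?lab (pc s) = ?lab p + 5"
              using False \<open>p < length P\<close> by (simp add: s_def less)
            moreover have "simulates w E R (regs s) (mem s) (r1'(5 := 0)) m1'"
              using simulates_scratch(1)[OF Suc.prems(1)] by (simp add: s_def less)
            moreover have "preserved w r' m' (r1'(5 := 0)) m1'"
              using Suc.prems(2) by (simp add: preserved_def)
            ultimately show ?thesis
              by (intro exI[of _ "4 + 1"]) auto
          qed
        qed
      qed
      then obtain u r2 m2 where u: "u \<le> 5"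
        "(step w' ?Q ^^ u) \<lparr>pc = ?lab p, regs = r1', mem = m1'\<rparr> = \<lparr>pc = ?lab (pc s), regs = r2, mem = m2\<rparr>"
        "simulates w E R (regs s) (mem s) r2 m2" "preserved w r' m' r2 m2"
        by blast
      have s_eta: "\<lparr>pc = pc s, regs = regs s, mem = mem s\<rparr> = s" by simp
      have steps: "(step w P ^^ Suc t) \<lparr>pc = p, regs = r1, mem = m1\<rparr> = (step w P ^^ t) s"
        by (simp only: funpow_Suc_right comp_def s)
      obtain v r3 m3 where v: "v \<le> 5 * t"
        "(step w' ?Q ^^ v) \<lparr>pc = ?lab (pc s), regs = r2, mem = m2\<rparr> =
           \<lparr>pc = ?p + 5 * length P, regs = r3, mem = m3\<rparr>"
        "let s = (step w P ^^ t) s in simulates w E R (regs s) (mem s) r3 m3 \<and> preserved w r' m' r3 m3"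
        using Suc.IH[OF u(3,4), of "pc s"] Suc.prems(3) unfolding steps s_eta by blast
      have "(step w' ?Q ^^ (v + u)) \<lparr>pc = ?lab p, regs = r1', mem = m1'\<rparr> =
           \<lparr>pc = ?p + 5 * length P, regs = r3, mem = m3\<rparr>"
        by (simp only: funpow_add comp_def u(2) v(2))
      moreover have "v + u \<le> 5 * Suc t" using u(1) v(1) by simp
      ultimately show ?thesis using v(3) unfolding steps by blast
    qed
  qed
  have "preserved w r' m' r' m'" by (simp add: preserved_def)
  from main[OF sim this halt]
  show "\<exists>u\<le>5 * t. \<exists>r'' m''. (step w' ?Q ^^ u) \<lparr>pc = ?p, regs = r', mem = m'\<rparr> =
       \<lparr>pc = ?p + length (compile P ?p), regs = r'', mem = m''\<rparr> \<and>
       (let s = (step w P ^^ t) \<lparr>pc = 0, regs = r, mem = m\<rparr>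
        in simulates w E R (regs s) (mem s) r'' m'' \<and> preserved w r' m' r'' m'')"
    by simp
qed

end

section \<open>Loops over matrix entries\<close>

text \<open>
  The reduction keeps 1 in register 1, the number \<open>n\<^sup>2\<close> of matrix entries in register 7 and the loop
  counter in register 8. Besides registers 5 and 6, also 13 and 14 are scratch.
\<close>

definition for_code :: "instr list \<Rightarrow> code" where
  "for_code body = (\<lambda>_. [Const 8 0]) ;; while_code 8 7 (\<lambda>_. body @ [Op Add 8 8 1])"

definition agree :: "(nat \<Rightarrow> nat) \<Rightarrow> (nat \<Rightarrow> nat) \<Rightarrow> bool" where
  "agree r r' \<longleftrightarrow> (\<forall>a. a \<notin> {5, 6, 8, 13, 14} \<longrightarrow> r a = r' a)"

fun writes :: "instr \<Rightarrow> nat set" where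
  "writes (Const r v) = {r}"
| "writes (Op f r a b) = {r}"
| "writes (Load r a) = {r}"
| "writes _ = {}"

lemma regs_fold_exec:
  assumes "list_all (\<lambda>i. a \<notin> writes i) is"
  shows "regs (fold (exec_instr w) is s) a = regs s a"
  using assms
proof (induction "is" arbitrary: s)
  case (Cons i is')
  have "regs (exec_instr w i s) a = regs s a"
    using Cons.prems by (cases i) auto
  with Cons show ?case by simp
qed simp

text \<open>\<open>G t\<close> is the memory after \<open>t\<close> iterations, given in closed form
  by the user of the rule; registers change only within the scratch set. The 3 per iteration are
  increment, test and jump back.\<close>

lemma runs_for:
  assumes body: "list_all straight body" "list_all (\<lambda>i. writes i \<subseteq> {5, 6, 13, 14}) body"
    and N: "r0 7 = N" "N < 2 ^ w" "r0 1 = 1"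
    and init: "G 0 = m0"
    and step: "\<And>t r. t < N \<Longrightarrow> r 8 = t \<Longrightarrow> agree r r0 \<Longrightarrow>
      mem (fold (exec_instr w) body \<lparr>pc = 0, regs = r, mem = G t\<rparr>) = G (Suc t)"
  shows "runs w (for_code body) r0 m0 (1 + (N * (length body + 3) + 2))
    (\<lambda>r m. agree r r0 \<and> m = G N)"
proof -
  define I where "I t r m \<longleftrightarrow> r 8 = t \<and> agree r r0 \<and> m = G t" for t r m
  have "runs w (for_code body) r0 m0 (length [Const 8 0] + (N * (length (body @ [Op Add 8 8 1]) + 2) + 2)) (I N)"
    unfolding for_code_def
  proof (rule runs_seq)
    show "runs w (\<lambda>_. [Const 8 0]) r0 m0 (length [Const 8 0]) (I 0)"
      by (rule runs_straight) (auto simp: I_def agree_def init)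
  next
    fix r m assume "I 0 r m"
    then show "runs w (while_code 8 7 (\<lambda>_. body @ [Op Add 8 8 1])) r m
        (N * (length (body @ [Op Add 8 8 1]) + 2) + 2) (I N)"
    proof (rule runs_while[where I = I])
      fix t r m assume t: "t < N" "I t r m"
      have r: "r 8 = t" "agree r r0" "m = G t" "r 7 = N" "r 1 = 1"
        using t N by (auto simp: I_def agree_def)
      have "runs w (\<lambda>_. body @ [Op Add 8 8 1]) r m (length (body @ [Op Add 8 8 1])) (I (Suc t))"
      proof (rule runs_straight)
        fix s assume s: "s = fold (exec_instr w) (body @ [Op Add 8 8 1]) \<lparr>pc = 0, regs = r, mem = m\<rparr>"
        define s1 where "s1 = fold (exec_instr w) body \<lparr>pc = 0, regs = r, mem = m\<rparr>"
        have s1: "regs s1 a = r a" if "a \<notin> {5, 6, 13, 14}" for a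
          unfolding s1_def using body(2) that
          by (subst regs_fold_exec) (auto simp: list_all_iff)
        have "regs s = (regs s1)(8 := take_bit w (regs s1 8 + regs s1 1))" "mem s = mem s1"
          by (simp_all add: s s1_def)
        moreover have "take_bit w (regs s1 8 + regs s1 1) = Suc t"
          using s1[of 8] s1[of 1] r t(1) N(2) by (simp add: take_bit_nat_eq_self)
        moreover have "mem s1 = G (Suc t)"
          unfolding s1_def r(3) by (rule step) (use r t in auto)
        moreover have "agree (regs s1) r0"
          using r(2) s1 by (auto simp: agree_def)
        ultimately show "I (Suc t) (regs s) (mem s)"
          by (simp add: I_def agree_def)
      qed (use body in simp)
      then show "r 8 < r 7 \<and> runs w (\<lambda>_. body @ [Op Add 8 8 1]) r m (length (body @ [Op Add 8 8 1])) (I (Suc t))"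
        using r t by simp
    next
      fix r m assume "I N r m"
      then show "\<not> r 8 < r 7" using N by (auto simp: I_def agree_def)
    qed
  qed
  then show ?thesis
    by (rule runs_mono) (auto simp: I_def algebra_simps)
qed

section \<open>The reduction\<close>

text \<open>The machine is not told its word length, so \<open>2 ^ w\<close> is computed: register 2
  doubles until it reaches \<open>n + 2\<close>, which takes \<open>ceillog2 (n + 2)\<close>
  iterations, and register 3 is multiplied by \<open>2 ^ c\<close> each time. Half of
  \<open>2 ^ w\<close>, and that half times \<open>2 ^ w\<close>, are \<open>2 ^ (w - 1)\<close> and
  \<open>2 ^ (w' - 1)\<close>; minus 1 they are the codes of infinity for narrow and wide words.
  Register 2 is then reused for the distance range.\<close>

definition prologue :: "nat \<Rightarrow> code" where
  "prologue c = (\<lambda>_. [Const 1 1, Op Mul 7 0 0, Const 9 2, Op Add 9 9 0, Const 10 c, Const 2 1, Const 3 1,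
       Op Add 12 0 1]) ;;
     while_code 2 9 (\<lambda>_. [Op Add 2 2 2, Op ShiftL 3 3 10]) ;;
     (\<lambda>_. [Op Add 5 1 1, Op Div 10 3 5, Op Mul 11 10 3, Op Sub 10 10 1, Op Sub 11 11 1, Const 4 0, Const 2 1])"

text \<open>
  All loop bodies are free of branches. The entry with index \<open>t\<close> lies on the diagonal iff \<open>n + 1\<close> divides \<open>t\<close>,
  and for an entry \<open>x\<close> the quotient of \<open>x\<close> by the code of \<open>\<infinity>\<close> in register 10 is 1 if \<open>x\<close> is \<open>\<infinity>\<close> and 0 otherwise.
\<close>

definition init_body :: "instr list" where
  "init_body = [Load 5 8, Op Mod 13 8 12, Op Add 13 13 1, Op Div 13 1 13, Op Sub 13 1 13,
     Op Sub 14 10 1, Op Mul 5 5 14, Op Sub 5 10 5, Op Mul 5 5 13, Store 8 5]"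

text \<open>Register 6 is the indicator of infinity. Twice the code of infinity minus one copy is
  that code again, so one subtraction doubles finite entries and fixes infinity; adding the
  complement of the indicator makes finite entries odd.\<close>

definition pack_body :: "instr list" where
  "pack_body = [Load 5 8, Op Div 6 5 10, Op Add 5 5 5, Op Mul 13 6 10, Op Sub 5 5 13,
     Op Add 13 8 3, Op Add 14 5 4, Store 13 14,
     Op Sub 6 1 6, Op Add 5 5 6, Op Add 13 13 7, Op Add 14 5 4, Store 13 14]"

text \<open>Restores the registers of \<open>init_config\<close>: the last instruction puts
  \<open>n\<close> into simulated register 0.\<close>

definition reset_code :: "nat \<Rightarrow> instr list" where
  "reset_code R = map (\<lambda>i. Const (i + 16) 0) [0..<R] @ [Op Add 16 16 0]"

text \<open>The product holds \<open>d + 1\<close>. Adding the indicator of infinity before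
  subtracting 1 decrements finite entries only.\<close>

definition unpack_body :: "instr list" where
  "unpack_body = [Op Add 13 8 3, Op Add 13 13 7, Op Add 13 13 7, Load 5 13, Op Mod 6 5 3,
     Op Div 5 5 4, Op Mul 5 6 5, Op Div 6 5 10, Op Add 5 5 6, Op Sub 5 5 1, Store 8 5]"

text \<open>The first instruction opens a new epoch and thereby blanks the simulated memory.
  Register 2 is the distance range covered so far, which a round doubles.\<close>

definition round_code :: "program \<Rightarrow> nat \<Rightarrow> code" where
  "round_code P R = (\<lambda>_. [Op Add 4 4 3]) ;; for_code pack_body ;; (\<lambda>_. reset_code R) ;; compile P ;;
     for_code unpack_body ;; (\<lambda>_. [Op Add 2 2 2])"

text \<open>Infinity has different codes at the two widths; the difference of registers 11 and 10
  converts one into the other.\<close>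

definition output_body :: "instr list" where
  "output_body = [Load 5 8, Op Div 6 5 10, Op Sub 13 11 10, Op Mul 6 6 13, Op Add 5 5 6,
     Op Add 13 8 7, Store 13 5]"

definition apsp_code :: "nat \<Rightarrow> program \<Rightarrow> nat \<Rightarrow> code" where
  "apsp_code c P R =
     prologue c ;; for_code init_body ;; while_code 2 0 (round_code P R) ;; for_code output_body"

section \<open>Word sizes, the code of infinity, and wide arithmetic without wrap-around\<close>

locale reduction =
  fixes n c :: nat
  assumes c: "3 \<le> c"
begin

definition "w = word_length c n"
definition "w' = word_length (2 * c) n"
definition M :: nat where "M = 2 ^ w"
definition inf_code :: nat where "inf_code = M div 2 - 1"

lemma w'_eq: "w' = 2 * w"
  by (simp add: w'_def w_def word_length_def)

lemma pow_w': "2 ^ w' = M * M"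
  by (simp add: w'_eq M_def power_add mult_2)

text \<open>All size estimates rest on this consequence of \<open>3 \<le> c\<close>: room for three
  matrices, finite entries below the code of infinity, and enough epochs.\<close>

lemma M_ge: "(n + 2) ^ 3 \<le> M"
proof -
  have "(n + 2) ^ 3 \<le> (2 ^ ceillog2 (n + 2)) ^ 3"
    by (intro power_mono le_two_power_ceillog2) simp
  also have "\<dots> = 2 ^ (3 * ceillog2 (n + 2))"
    by (simp add: power_mult[symmetric] mult.commute)
  also have "\<dots> \<le> M"
    unfolding M_def w_def word_length_def using c by (intro power_increasing mult_le_mono1) auto
  finally show ?thesis .
qed

lemma cube: "(n + 2) ^ 3 = n * n * n + 6 * (n * n) + 12 * n + 8"
  by (simp add: power3_eq_cube algebra_simps)

lemma M_bounds: "8 \<le> M" "3 * (n * n) < M" "12 * n + 8 \<le> M" "6 * (n * n) + 12 * n + 8 \<le> M"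
  using M_ge cube by linarith+

lemma w_ge: "3 \<le> w"
proof (rule ccontr)
  assume "\<not> 3 \<le> w"
  then have "(2::nat) ^ w \<le> 2 ^ 2" by (intro power_increasing) auto
  then show False using M_bounds(1) by (simp add: M_def)
qed

lemma M_eq: "M = 2 * (inf_code + 1)"
proof -
  have "even M" using w_ge by (simp add: M_def)
  then show ?thesis using M_bounds(1) by (auto simp: inf_code_def elim!: evenE)
qed

lemma inf_code_eq: "inf_code = 2 ^ (w - 1) - 1"
  using w_ge by (cases w) (simp_all add: inf_code_def M_def)

lemma inf_code_ge: "2 * n + 3 \<le> inf_code"
  using M_eq M_bounds(3) by simp

lemma inf_code_less: "inf_code < M"
  using M_eq by simp


lemma eval_add: "a + b < M * M \<Longrightarrow> eval_binop w' Add a b = a + b"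
  by (simp add: take_bit_nat_eq_self pow_w')

lemma eval_sub:
  assumes "b \<le> a" "a < M * M"
  shows "eval_binop w' Sub a b = a - b"
proof -
  have "a + M * M - b = (a - b) + M * M" using assms(1) by simp
  then show ?thesis
    unfolding eval_binop.simps take_bit_eq_mod pow_w' using assms by (simp only: mod_add_self2) simp
qed

lemma eval_mul: "a * b < M * M \<Longrightarrow> eval_binop w' Mul a b = a * b"
  by (simp add: take_bit_nat_eq_self pow_w')

lemma eval_div: "a < M * M \<Longrightarrow> eval_binop w' Div a b = a div b"
  by (simp add: take_bit_nat_eq_self pow_w' le_less_trans[OF div_le_dividend])

lemma eval_mod: "a < M * M \<Longrightarrow> eval_binop w' Mod a b = a mod b"
  by (simp add: take_bit_nat_eq_self pow_w' le_less_trans[OF mod_less_eq_dividend])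

lemma eval_shiftl: "a * 2 ^ b < M * M \<Longrightarrow> eval_binop w' ShiftL a b = a * 2 ^ b"
  by (simp add: take_bit_nat_eq_self pow_w' push_bit_eq_mult)

lemmas eval = eval_add eval_sub eval_mul eval_div eval_mod eval_shiftl

lemma MM_ge8: "8 * M \<le> M * M"
  using M_bounds(1) by simp

text \<open>Most intermediate values are small sums of narrow words; below \<open>8 * M\<close> none
  of them wraps.\<close>

lemma less_MM: "a < 8 * M \<Longrightarrow> a < M * M"
  using MM_ge8 by linarith

end

text \<open>For \<open>t = i * n + j\<close> one has \<open>t = i * (n + 1) + (j - i)\<close> over
  the integers, and \<open>j - i\<close> lies strictly between \<open>- n\<close> and
  \<open>n\<close>, so \<open>n + 1\<close> divides it only if it is 0.\<close>

lemma mod_Suc_eq_0_iff: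
  fixes t n :: nat
  assumes "t < n * n"
  shows "t mod (n + 1) = 0 \<longleftrightarrow> t div n = t mod n"
proof -
  have n: "0 < n" using assms by (cases n) auto
  define i j where "i = t div n" and "j = t mod n"
  have ij: "i < n" "j < n" "t = i * n + j"
    using assms n by (auto simp: i_def j_def less_mult_imp_div_less)
  show ?thesis
  proof (cases "j \<ge> i")
    case True
    then have "t = i * (n + 1) + (j - i)" using ij by (simp add: algebra_simps)
    moreover have "j - i < n + 1" using ij by simp
    ultimately have "t mod (n + 1) = j - i" by (metis mod_less mod_mult_self3)
    then show ?thesis using True i_def j_def by auto
  next
    case False
    then obtain i' where i': "i = Suc i'" by (cases i) auto
    have "t = i' * (n + 1) + (n + 1 + j - i)" using ij False by (simp add: i' algebra_simps)
    moreover have "n + 1 + j - i < n + 1" "n + 1 + j - i > 0" using False ij by auto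
    ultimately have "t mod (n + 1) = n + 1 + j - i" by (metis mod_less mod_mult_self3)
    then show ?thesis using False \<open>n + 1 + j - i > 0\<close> i_def j_def by auto
  qed
qed

section \<open>Effects of the four loops over the matrix entries\<close>

context reduction
begin

definition ready :: "nat \<Rightarrow> (nat \<Rightarrow> nat) \<Rightarrow> bool" where
  "ready E r \<longleftrightarrow> r 0 = n \<and> r 1 = 1 \<and> r 3 = M \<and> r 4 = E \<and> r 7 = n * n \<and>
     r 10 = inf_code \<and> r 11 = 2 ^ (w' - 1) - 1 \<and> r 12 = n + 1"

lemma ready_agree: "agree r r0 \<Longrightarrow> ready E r0 \<Longrightarrow> ready E r"
  by (simp add: ready_def agree_def)

text \<open>The diagonal takes precedence: a loop arc does not change the distance 0.\<close>

definition init_cell :: "(nat \<Rightarrow> nat) \<Rightarrow> nat \<Rightarrow> nat" where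
  "init_cell m t = (if t div n = t mod n then 0 else if m t = 1 then 1 else inf_code)"

lemma runs_init:
  assumes r: "ready E r" and m: "\<And>t. t < n * n \<Longrightarrow> m t \<le> 1"
  shows "runs w' (for_code init_body) r m (13 * (n * n) + 3)
    (\<lambda>r' m'. agree r' r \<and> m' = (\<lambda>a. if a < n * n then init_cell m a else m a))"
proof -
  define G where "G t = (\<lambda>a. if a < t then init_cell m a else m a)" for t
  have "runs w' (for_code init_body) r m (1 + (n * n * (length init_body + 3) + 2))
    (\<lambda>r' m'. agree r' r \<and> m' = G (n * n))"
  proof (rule runs_for)
    show "list_all straight init_body" "list_all (\<lambda>i. writes i \<subseteq> {5, 6, 13, 14}) init_body"
      by (simp_all add: init_body_def)
    show "r 7 = n * n" "r 1 = 1" using r by (simp_all add: ready_def)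
    show "n * n < 2 ^ w'"
      unfolding pow_w' using M_bounds(2) by (intro less_MM) simp
    show "G 0 = m" by (simp add: G_def)
  next
    fix t q assume t: "t < n * n" and q8: "q 8 = t" and "agree q r"
    then have q: "ready E q" using r by (blast intro: ready_agree)
    \<comment> \<open>\<open>?d\<close> is the indicator of the diagonal, and
      \<open>inf_code - ?x * (inf_code - 1)\<close> sends adjacency bit 0 to infinity and bit 1 to
      1.\<close>
    let ?x = "m t" and ?d = "1 div (t mod (n + 1) + 1)"
    have x: "?x \<le> 1" using m t .
    have d: "?d = of_bool (t div n = t mod n)"
      using mod_Suc_eq_0_iff[OF t] by (cases "t mod (n + 1) = 0") auto
    have tM: "t < M" using t M_bounds(2) by linarith
    have nM: "n + 1 < M" using M_bounds by linarith
    have x': "?x * (inf_code - 1) \<le> inf_code"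
      using x by (cases "?x = 0") (auto simp: le_Suc_eq)
    have x'': "(inf_code - ?x * (inf_code - 1)) * (1 - ?d) \<le> inf_code"
      by (rule order_trans[OF mult_le_mono[OF diff_le_self diff_le_self]]) simp
    have d1: "?d \<le> 1" by (rule div_le_dividend)
    have tm: "t mod (n + 1) + 1 \<le> n + 1" using mod_less_divisor[of "n + 1" t] by linarith
    have e: "eval_binop w' Mod t (n + 1) = t mod (n + 1)"
      "eval_binop w' Add (t mod (n + 1)) 1 = t mod (n + 1) + 1"
      "eval_binop w' Div 1 (t mod (n + 1) + 1) = ?d"
      "eval_binop w' Sub 1 ?d = 1 - ?d"
      "eval_binop w' Sub inf_code 1 = inf_code - 1"
      "eval_binop w' Mul ?x (inf_code - 1) = ?x * (inf_code - 1)"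
      "eval_binop w' Sub inf_code (?x * (inf_code - 1)) = inf_code - ?x * (inf_code - 1)"
      "eval_binop w' Mul (inf_code - ?x * (inf_code - 1)) (1 - ?d) = (inf_code - ?x * (inf_code - 1)) * (1 - ?d)"
      using x' x'' tM nM d1 tm inf_code_less inf_code_ge
      by (auto intro!: eval less_MM simp del: eval_binop.simps One_nat_def)
    have "(inf_code - ?x * (inf_code - 1)) * (1 - ?d) = init_cell m t"
      using x inf_code_ge unfolding d by (auto simp: init_cell_def le_Suc_eq)
    moreover have "G t t = m t" by (simp add: G_def)
    ultimately have "mem (fold (exec_instr w') init_body \<lparr>pc = 0, regs = q, mem = G t\<rparr>) = (G t)(t := init_cell m t)"
      using q q8 by (simp add: init_body_def ready_def e del: eval_binop.simps One_nat_def)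
    then show "mem (fold (exec_instr w') init_body \<lparr>pc = 0, regs = q, mem = G t\<rparr>) = G (Suc t)"
      by (auto simp: G_def)
  qed
  then show ?thesis
    by (rule runs_mono) (auto simp: G_def init_body_def)
qed


definition double :: "nat \<Rightarrow> nat" where
  "double x = 2 * x - x div inf_code * inf_code"

definition double_Suc :: "nat \<Rightarrow> nat" where
  "double_Suc x = double x + (1 - x div inf_code)"

definition packed :: "nat \<Rightarrow> nat \<Rightarrow> (nat \<Rightarrow> nat) \<Rightarrow> nat \<Rightarrow> nat" where
  "packed E t m = (\<lambda>a. if M \<le> a \<and> a < M + t then double (m (a - M)) + E
     else if M + n * n \<le> a \<and> a < M + n * n + t then double_Suc (m (a - M - n * n)) + E else m a)"

lemma div_inf_code:
  assumes "x \<le> inf_code"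
  shows "x div inf_code = (if x = inf_code then 1 else 0)"
  using assms inf_code_ge by auto

lemma runs_pack:
  assumes r: "ready E r" and m: "\<And>t. t < n * n \<Longrightarrow> m t \<le> inf_code" and E: "E + 2 * M \<le> M * M"
  shows "runs w' (for_code pack_body) r m (16 * (n * n) + 3)
    (\<lambda>r' m'. agree r' r \<and> m' = packed E (n * n) m)"
proof -
  have "runs w' (for_code pack_body) r m (1 + (n * n * (length pack_body + 3) + 2))
    (\<lambda>r' m'. agree r' r \<and> m' = packed E (n * n) m)"
  proof (rule runs_for)
    show "list_all straight pack_body" "list_all (\<lambda>i. writes i \<subseteq> {5, 6, 13, 14}) pack_body"
      by (simp_all add: pack_body_def)
    show "r 7 = n * n" "r 1 = 1" using r by (simp_all add: ready_def)
    show "n * n < 2 ^ w'"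
      unfolding pow_w' using M_bounds(2) by (intro less_MM) simp
    show "packed E 0 m = m" by (auto simp: packed_def)
  next
    fix t q assume t: "t < n * n" and q8: "q 8 = t" and "agree q r"
    then have q: "ready E q" using r by (blast intro: ready_agree)
    let ?x = "m t" and ?f = "m t div inf_code"
    have x: "?x \<le> inf_code" using m t .
    have nM: "3 * (n * n) < M" by (rule M_bounds)
    have f: "?f \<le> 1" "?f * inf_code \<le> ?x" using x by (auto simp: div_inf_code)
    have double: "?x + ?x - ?f * inf_code = double ?x" "double ?x + (1 - ?f) = double_Suc ?x"
      by (simp_all add: double_def double_Suc_def)
    have dM: "double ?x < 2 * M" "double_Suc ?x < 2 * M"
      using x inf_code_less M_eq by (auto simp: double_def double_Suc_def div_inf_code)
    have e: "eval_binop w' Div ?x inf_code = ?f"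
      "eval_binop w' Add ?x ?x = ?x + ?x"
      "eval_binop w' Mul ?f inf_code = ?f * inf_code"
      "eval_binop w' Sub (?x + ?x) (?f * inf_code) = ?x + ?x - ?f * inf_code"
      "eval_binop w' Add t M = t + M"
      "eval_binop w' Add (double ?x) E = double ?x + E"
      "eval_binop w' Sub 1 ?f = 1 - ?f"
      "eval_binop w' Add (double ?x) (1 - ?f) = double ?x + (1 - ?f)"
      "eval_binop w' Add (t + M) (n * n) = t + M + n * n"
      "eval_binop w' Add (double_Suc ?x) E = double_Suc ?x + E"
      by (rule eval; use x f dM double t nM inf_code_less E MM_ge8 M_bounds(1) in linarith)+
    have Gt: "packed E t m t = ?x"
      using t nM by (auto simp: packed_def)
    have "mem (fold (exec_instr w') pack_body \<lparr>pc = 0, regs = q, mem = packed E t m\<rparr>) =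
        (packed E t m)(t + M := double ?x + E, t + M + n * n := double_Suc ?x + E)"
      using q q8 by (simp add: pack_body_def ready_def e Gt double del: eval_binop.simps One_nat_def)
    also have "\<dots> = packed E (Suc t) m"
      using t by (auto simp: packed_def fun_eq_iff)
    finally show "mem (fold (exec_instr w') pack_body \<lparr>pc = 0, regs = q, mem = packed E t m\<rparr>) =
        packed E (Suc t) m" .
  qed
  then show ?thesis
    by (rule runs_mono) (auto simp: pack_body_def)
qed

definition unpack_cell :: "nat \<Rightarrow> (nat \<Rightarrow> nat) \<Rightarrow> nat \<Rightarrow> nat" where
  "unpack_cell E m t = (let y = decode_cell w E (m (t + M + n * n + n * n)) in y + y div inf_code - 1)"

lemma runs_unpack:
  assumes r: "ready E r"
    and m: "\<And>t. t < n * n \<Longrightarrow> m (t + M + n * n + n * n) < E + M \<and>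
        decode_cell w E (m (t + M + n * n + n * n)) \<in> {1..inf_code}"
    and E: "E + M \<le> M * M"
  shows "runs w' (for_code unpack_body) r m (14 * (n * n) + 3)
    (\<lambda>r' m'. agree r' r \<and> m' = (\<lambda>a. if a < n * n then unpack_cell E m a else m a))"
proof -
  define G where "G t = (\<lambda>a. if a < t then unpack_cell E m a else m a)" for t
  have "runs w' (for_code unpack_body) r m (1 + (n * n * (length unpack_body + 3) + 2))
    (\<lambda>r' m'. agree r' r \<and> m' = G (n * n))"
  proof (rule runs_for)
    show "list_all straight unpack_body" "list_all (\<lambda>i. writes i \<subseteq> {5, 6, 13, 14}) unpack_body"
      by (simp_all add: unpack_body_def)
    show "r 7 = n * n" "r 1 = 1" using r by (simp_all add: ready_def)
    show "n * n < 2 ^ w'"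
      unfolding pow_w' using M_bounds(2) by (intro less_MM) simp
    show "G 0 = m" by (simp add: G_def)
  next
    fix t q assume t: "t < n * n" and q8: "q 8 = t" and "agree q r"
    then have q: "ready E q" using r by (blast intro: ready_agree)
    have nM: "3 * (n * n) < M" by (rule M_bounds)
    let ?x = "m (t + M + n * n + n * n)"
    define y where "y = decode_cell w E ?x"
    have y: "1 \<le> y" "y \<le> inf_code" and x: "?x < M * M"
      using m[OF t] E unfolding y_def by auto
    have f: "y div inf_code \<le> 1" using y by (auto simp: div_inf_code)
    have y_eq: "?x mod M * (?x div E) = y" by (simp add: y_def decode_cell_def M_def)
    have e: "eval_binop w' Add t M = t + M"
      "eval_binop w' Add (t + M) (n * n) = t + M + n * n"
      "eval_binop w' Add (t + M + n * n) (n * n) = t + M + n * n + n * n"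
      "eval_binop w' Mod ?x M = ?x mod M"
      "eval_binop w' Div ?x E = ?x div E"
      "eval_binop w' Mul (?x mod M) (?x div E) = y"
      "eval_binop w' Div y inf_code = y div inf_code"
      "eval_binop w' Add y (y div inf_code) = y + y div inf_code"
      "eval_binop w' Sub (y + y div inf_code) 1 = y + y div inf_code - 1"
      unfolding y_eq[symmetric]
      by (rule eval; use x y[unfolded y_eq[symmetric]] f[unfolded y_eq[symmetric]] t nM inf_code_less in \<open>auto intro!: less_MM simp del: One_nat_def\<close>)+
    have Gt: "G t (t + M + n * n + n * n) = ?x"
      using t nM by (simp add: G_def)
    have "mem (fold (exec_instr w') unpack_body \<lparr>pc = 0, regs = q, mem = G t\<rparr>) =
        (G t)(t := y + y div inf_code - 1)"
      using q q8 by (simp add: unpack_body_def ready_def e Gt del: eval_binop.simps One_nat_def)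
    also have "\<dots> = G (Suc t)"
      by (auto simp: G_def unpack_cell_def y_def fun_eq_iff Let_def)
    finally show "mem (fold (exec_instr w') unpack_body \<lparr>pc = 0, regs = q, mem = G t\<rparr>) = G (Suc t)" .
  qed
  then show ?thesis
    by (rule runs_mono) (auto simp: G_def unpack_body_def)
qed

definition output_cell :: "nat \<Rightarrow> nat" where
  "output_cell x = (if x = inf_code then 2 ^ (w' - 1) - 1 else x)"

lemma inf_code_le_output: "inf_code \<le> 2 ^ (w' - 1) - 1" "2 ^ (w' - 1) - 1 < M * M"
proof -
  have "(2::nat) ^ (w - 1) \<le> 2 ^ (w' - 1)"
    by (intro power_increasing) (auto simp: w'_eq)
  then show "inf_code \<le> 2 ^ (w' - 1) - 1"
    unfolding inf_code_eq by (rule diff_le_mono)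
  have "(2::nat) ^ (w' - 1) \<le> 2 ^ w'" by (intro power_increasing) auto
  moreover have "(0::nat) < 2 ^ (w' - 1)" by simp
  ultimately show "2 ^ (w' - 1) - 1 < M * M"
    unfolding pow_w'[symmetric] by linarith
qed

lemma runs_output:
  assumes r: "ready E r" and m: "\<And>t. t < n * n \<Longrightarrow> m t \<le> inf_code"
  shows "runs w' (for_code output_body) r m (10 * (n * n) + 3)
    (\<lambda>r' m'. \<forall>t < n * n. m' (n * n + t) = output_cell (m t))"
proof -
  define G where "G t = (\<lambda>a. if n * n \<le> a \<and> a < n * n + t then output_cell (m (a - n * n)) else m a)" for t
  define J :: nat where "J = 2 ^ (w' - 1) - 1"
  have J: "inf_code \<le> J" "J < M * M" unfolding J_def by (rule inf_code_le_output)+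
  have "runs w' (for_code output_body) r m (1 + (n * n * (length output_body + 3) + 2))
    (\<lambda>r' m'. agree r' r \<and> m' = G (n * n))"
  proof (rule runs_for)
    show "list_all straight output_body" "list_all (\<lambda>i. writes i \<subseteq> {5, 6, 13, 14}) output_body"
      by (simp_all add: output_body_def)
    show "r 7 = n * n" "r 1 = 1" using r by (simp_all add: ready_def)
    show "n * n < 2 ^ w'"
      unfolding pow_w' using M_bounds(2) by (intro less_MM) simp
    show "G 0 = m" by (auto simp: G_def)
  next
    fix t q assume t: "t < n * n" and q8: "q 8 = t" and "agree q r"
    then have q: "ready E q" using r by (blast intro: ready_agree)
    have nM: "3 * (n * n) < M" by (rule M_bounds)
    let ?x = "m t"
    have x: "?x \<le> inf_code" using m t .
    have f: "?x + ?x div inf_code * (J - inf_code) = output_cell ?x"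
      using x J by (auto simp: div_inf_code output_cell_def J_def[symmetric] simp del: One_nat_def)
    have o: "output_cell ?x < M * M"
      using x J inf_code_less by (auto simp: output_cell_def J_def[symmetric] simp del: One_nat_def intro: less_MM)
    have e: "eval_binop w' Div ?x inf_code = ?x div inf_code"
      "eval_binop w' Sub J inf_code = J - inf_code"
      "eval_binop w' Mul (?x div inf_code) (J - inf_code) = ?x div inf_code * (J - inf_code)"
      "eval_binop w' Add ?x (?x div inf_code * (J - inf_code)) = ?x + ?x div inf_code * (J - inf_code)"
      "eval_binop w' Add t (n * n) = t + n * n"
      by (rule eval; use x f o J t nM inf_code_less in \<open>auto intro!: less_MM simp del: One_nat_def\<close>)+
    have Gt: "G t t = ?x" using t by (simp add: G_def)
    have "mem (fold (exec_instr w') output_body \<lparr>pc = 0, regs = q, mem = G t\<rparr>) =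
        (G t)(t + n * n := output_cell ?x)"
      using q q8 by (simp add: output_body_def ready_def e Gt f J_def[symmetric] del: eval_binop.simps One_nat_def)
    also have "\<dots> = G (Suc t)"
      by (auto simp: G_def fun_eq_iff)
    finally show "mem (fold (exec_instr w') output_body \<lparr>pc = 0, regs = q, mem = G t\<rparr>) = G (Suc t)" .
  qed
  then show ?thesis
    by (rule runs_mono) (auto simp: G_def output_body_def)
qed

end

section \<open>The prologue and a single round\<close>

lemma fold_reset:
  "fold (exec_instr w) (map (\<lambda>i. Const (i + 16) 0) [0..<R]) \<lparr>pc = p, regs = r, mem = m\<rparr> =
     \<lparr>pc = p + R, regs = (\<lambda>a. if 16 \<le> a \<and> a < R + 16 then 0 else r a), mem = m\<rparr>"
  by (induction R) (auto simp: fun_eq_iff)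

lemma less_ceillog2:
  assumes "0 < n" "i < ceillog2 n"
  shows "2 ^ i < n"
  using assms ceillog2_le_iff[of n i] by linarith

lemma index_less:
  fixes i j n :: nat
  assumes "i < n" "j < n"
  shows "i * n + j < n * n"
proof -
  have "i * n + j < Suc i * n" using assms(2) by simp
  also have "\<dots> \<le> n * n" using assms(1) by (intro mult_le_mono1) simp
  finally show ?thesis .
qed

context reduction
begin

lemma runs_prologue:
  assumes r: "r 0 = n"
  shows "runs w' (prologue c) r m (4 * ceillog2 (n + 2) + 17) (\<lambda>r' m'. ready 0 r' \<and> r' 2 = 1 \<and> m' = m)"
proof -
  let ?L = "ceillog2 (n + 2)"
  \<comment> \<open>The literal \<open>c\<close> must survive truncation for every
    \<open>n\<close>.\<close>
  have c_less: "c < M"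
  proof -
    have "1 \<le> ?L" using ceillog2_ge_iff[of "n + 2" 1] by simp
    then have "c \<le> w" by (simp add: w_def word_length_def)
    also have "w < M" unfolding M_def by (rule less_exp)
    finally show ?thesis .
  qed
  have nM: "12 * n + 8 \<le> M" "3 * (n * n) < M" by (rule M_bounds)+
  have const: "take_bit w' a = a" if "a < M" for a
    using that less_MM[of a] by (simp add: take_bit_nat_eq_self pow_w')
  have w'_ge: "6 \<le> w'" using w_ge by (simp add: w'_eq)
  define I where "I i q m' \<longleftrightarrow> q 0 = n \<and> q 1 = 1 \<and> q 7 = n * n \<and> q 9 = n + 2 \<and> q 10 = c \<and> q 12 = n + 1 \<and>
    q 2 = 2 ^ i \<and> q 3 = 2 ^ (c * i) \<and> m' = m" for i :: nat and q m' :: "nat \<Rightarrow> nat"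
  let ?c1 = "[Const 1 1, Op Mul 7 0 0, Const 9 2, Op Add 9 9 0, Const 10 c, Const 2 1, Const 3 1,
       Op Add 12 0 1]"
  let ?c2 = "[Op Add 2 2 2, Op ShiftL 3 3 10]"
  let ?c3 = "[Op Add 5 1 1, Op Div 10 3 5, Op Mul 11 10 3, Op Sub 10 10 1, Op Sub 11 11 1, Const 4 0, Const 2 1]"
  have "runs w' (prologue c) r m (length ?c1 + ((?L * (length ?c2 + 2) + 2) + length ?c3))
      (\<lambda>r' m'. ready 0 r' \<and> r' 2 = 1 \<and> m' = m)"
    unfolding prologue_def
  proof (rule runs_seq[where ?Q1.0 = "I 0"])
    have "eval_binop w' Mul n n = n * n" "eval_binop w' Add 2 n = n + 2" "eval_binop w' Add n 1 = n + 1"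
      using nM less_MM[of "n * n"] less_MM[of "2 + n"] less_MM[of "n + 1"] by (auto simp: eval simp del: eval_binop.simps)
    moreover have "take_bit w' c = c"
      using c_less by (rule const)
    ultimately show "runs w' (\<lambda>_. ?c1) r m (length ?c1) (I 0)"
      using w'_ge by (intro runs_straight) (simp_all add: I_def r del: eval_binop.simps One_nat_def)
  next
    fix r1 m1 assume I0: "I 0 r1 m1"
    show "runs w' (while_code 2 9 (\<lambda>_. ?c2) ;; (\<lambda>_. ?c3)) r1 m1 ((?L * (length ?c2 + 2) + 2) + length ?c3)
        (\<lambda>r' m'. ready 0 r' \<and> r' 2 = 1 \<and> m' = m)"
    proof (rule runs_seq[where ?Q1.0 = "I ?L"])
      show "runs w' (while_code 2 9 (\<lambda>_. ?c2)) r1 m1 (?L * (length ?c2 + 2) + 2) (I ?L)"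
      proof (rule runs_while[where I = I])
        show "I 0 r1 m1" by (rule I0)
      next
        fix i q m' assume i: "i < ?L" and I: "I i q m'"
        have less: "2 ^ i < n + 2" using i by (intro less_ceillog2) auto
        have "eval_binop w' Add (2 ^ i) (2 ^ i) = 2 ^ Suc i"
          using less nM less_MM[of "2 ^ i + 2 ^ i"] by (subst eval) auto
        moreover have "eval_binop w' ShiftL (2 ^ (c * i)) c = 2 ^ (c * Suc i)"
        proof -
          have "(2::nat) ^ (c * i) * 2 ^ c = 2 ^ (c * Suc i)" by (simp add: power_add)
          also have "\<dots> \<le> M"
            unfolding M_def w_def word_length_def using i by (intro power_increasing mult_le_mono2) auto
          finally have "(2::nat) ^ (c * i) * 2 ^ c < M * M" using less_MM[of "(2::nat) ^ (c * i) * 2 ^ c"] nM by linarith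
          then show ?thesis by (subst eval) (simp_all add: power_add)
        qed
        ultimately have "runs w' (\<lambda>_. ?c2) q m' (length ?c2) (I (Suc i))"
          using I by (intro runs_straight) (simp_all add: I_def del: eval_binop.simps One_nat_def power_Suc)
        then show "q 2 < q 9 \<and> runs w' (\<lambda>_. ?c2) q m' (length ?c2) (I (Suc i))"
          using less I by (simp add: I_def)
      next
        fix q m' assume "I ?L q m'"
        then show "\<not> q 2 < q 9"
          using le_two_power_ceillog2[of "n + 2"] by (simp add: I_def)
      qed
    next
      fix q m' assume I: "I ?L q m'"
      have q3: "q 3 = M" "q 1 = 1" "m' = m" using I by (simp_all add: I_def M_def w_def word_length_def)
      have half: "M div 2 = inf_code + 1" using M_eq by simp
      have J: "(inf_code + 1) * M - 1 = 2 ^ (w' - 1) - 1"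
      proof -
        have "2 * 2 ^ (w' - 1) = M * M"
          unfolding pow_w'[symmetric] power_Suc[symmetric] using w'_ge by simp
        also have "\<dots> = 2 * ((inf_code + 1) * M)" by (subst (1) M_eq) simp
        finally show ?thesis by simp
      qed
      have MM: "(inf_code + 1) * M < M * M" "M < M * M"
        using M_eq M_bounds(1) less_MM[of M] by (auto simp: algebra_simps)
      have e: "eval_binop w' Add 1 1 = 2"
        "eval_binop w' Div M 2 = inf_code + 1"
        "eval_binop w' Mul (inf_code + 1) M = (inf_code + 1) * M"
        "eval_binop w' Sub (inf_code + 1) 1 = inf_code"
        "eval_binop w' Sub ((inf_code + 1) * M) 1 = 2 ^ (w' - 1) - 1"
        unfolding half[symmetric] J[symmetric] using MM M_bounds(1) M_eq less_MM[of "inf_code + 1"] less_MM[of 2]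
        by (subst eval; simp add: half del: eval_binop.simps One_nat_def)+
      have q: "q 0 = n" "q 7 = n * n" "q 12 = n + 1" using I by (simp_all add: I_def)
      show "runs w' (\<lambda>_. ?c3) q m' (length ?c3) (\<lambda>r' m'. ready 0 r' \<and> r' 2 = 1 \<and> m' = m)"
        using w'_ge by (intro runs_straight)
          (simp_all add: ready_def q q3 e del: eval_binop.simps One_nat_def)
    qed
  qed
  then show ?thesis by (rule runs_mono) auto
qed

text \<open>Old cells lie below \<open>E + M\<close>, which is exactly the next epoch, so all of
  them read as blank; the run leaves them below \<open>E + M + M\<close>, ready for the following
  round. The slack \<open>3 * M\<close> is the new epoch plus the \<open>2 * M\<close> that
  \<open>runs_pack\<close> asks for.\<close>

lemma runs_round:
  assumes P: "0 < R" "\<forall>i\<in>set P. instr_regs i \<subseteq> {..<R}"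
    and r: "ready E r" "r 2 = k" "2 * k < M * M"
    and old: "\<And>a. a < M \<Longrightarrow> m (M + a) < E + M" and E: "E = M * e" "E + 3 * M \<le> M * M"
    and m: "\<And>t. t < n * n \<Longrightarrow> m t \<le> inf_code"
    and A: "\<And>i j. i < n \<Longrightarrow> j < n \<Longrightarrow> A i j = double (m (i * n + j))"
    and B: "\<And>i j. i < n \<Longrightarrow> j < n \<Longrightarrow> B i j = double_Suc (m (i * n + j))"
    and halts: "halts_within w P \<tau> (init_config n [A, B]) (matrix_at n (2 * n * n) C)"
    and C: "\<And>i j. i < n \<Longrightarrow> j < n \<Longrightarrow> C i j \<in> {1..inf_code}"
  shows "runs w' (round_code P R) r m (30 * (n * n) + R + 9 + 5 * nat \<lfloor>\<tau>\<rfloor>) (\<lambda>r' m'.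
    ready (E + M) r' \<and> r' 2 = 2 * k \<and> (\<forall>a<M. m' (M + a) < E + M + M) \<and>
    (\<forall>i<n. \<forall>j<n. m' (i * n + j) = C i j + C i j div inf_code - 1))"
proof -
  have nM: "12 * n + 8 \<le> M" "3 * (n * n) < M" by (rule M_bounds)+
  \<comment> \<open>The epoch \<open>M * (e + 1)\<close> of this round is positive even when
    \<open>E\<close> is 0, as in the first round.\<close>
  interpret sim: simulation w w' "e + 1" "E + M" R
    by unfold_locales (use E in \<open>simp_all add: M_def[symmetric] pow_w' algebra_simps\<close>)
  obtain t where t: "real t \<le> \<tau>"
    and halted: "halted P ((step w P ^^ t) (init_config n [A, B]))"
    and out: "matrix_at n (2 * n * n) C ((step w P ^^ t) (init_config n [A, B]))"
    using halts unfolding halts_within_def by blast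
  have t_le: "5 * t \<le> 5 * nat \<lfloor>\<tau>\<rfloor>" using t by (simp add: le_nat_floor)
  let ?r0 = "(\<lambda>_. 0)(0 := n) :: nat \<Rightarrow> nat"
  define m0 where "m0 = mem (init_config n [A, B])"
  have init: "init_config n [A, B] = \<lparr>pc = 0, regs = ?r0, mem = m0\<rparr>"
    by (simp add: m0_def init_config_def)
  define s where "s = (step w P ^^ t) (init_config n [A, B])"
  let ?m1 = "packed (E + M) (n * n) m"
  define Q1 where "Q1 r' m' \<longleftrightarrow> ready (E + M) r' \<and> r' 2 = k \<and> m' = m" for r' m'
  define Q2 where "Q2 r' m' \<longleftrightarrow> ready (E + M) r' \<and> r' 2 = k \<and> m' = ?m1" for r' m'
  define Q3 where "Q3 r' m' \<longleftrightarrow> Q2 r' m' \<and> simulates w (E + M) R ?r0 m0 r' m'" for r' m'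
  define Q4 where "Q4 r' m' \<longleftrightarrow> ready (E + M) r' \<and> r' 2 = k \<and> simulates w (E + M) R (regs s) (mem s) r' m'" for r' m'
  define Q5 where "Q5 r' m' \<longleftrightarrow> ready (E + M) r' \<and> r' 2 = k \<and> (\<forall>a<M. m' (M + a) < E + M + M) \<and>
    (\<forall>i<n. \<forall>j<n. m' (i * n + j) = C i j + C i j div inf_code - 1)" for r' m'
  have entry: "i < n \<and> j < n \<and> t = i * n + j" if "t < n * n" "i = t div n" "j = t mod n" for t i j
    using that by (cases "n = 0") (auto simp: less_mult_imp_div_less)
  \<comment> \<open>After packing, the memory decodes to the initial configuration: the two matrices
    carry the new tag, and every other cell is smaller than the new epoch and decodes to 0.\<close>
  have m0: "m0 a < 2 ^ w \<and> ?m1 (2 ^ w + a) < E + M + 2 ^ w \<and> m0 a = decode_cell w (E + M) (?m1 (2 ^ w + a))"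
    if a: "a < 2 ^ w" for a
  proof -
    have dM: "double x < 2 ^ w" "double_Suc x < 2 ^ w" if "x \<le> inf_code" for x
      using that inf_code_less M_eq by (auto simp: double_def double_Suc_def div_inf_code M_def[symmetric])
    have fresh: "decode_cell w (E + M) (v + (E + M)) = v" if "v < 2 ^ w" for v
      using decode_cell_fresh[OF that, of "e + 1"] E(1) by (simp add: M_def[symmetric] algebra_simps)
    consider "a < n * n" | t where "t < n * n" "a = n * n + t" | "2 * (n * n) \<le> a"
    proof (cases "a < n * n \<or> 2 * (n * n) \<le> a")
      case False
      then show ?thesis using that(2)[of "a - n * n"] by simp
    qed (use that in auto)
    then show ?thesis
    proof cases
      case 1
      define i j where "i = a div n" and "j = a mod n"
      have ij: "i < n" "j < n" "a = i * n + j" using entry[OF 1 i_def j_def] by auto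
      have "m0 a = A i j"
        using 1 ij by (simp add: m0_def init_config_def i_def[symmetric] j_def[symmetric])
      also have "\<dots> = double (m a)" using A ij by simp
      finally have "m0 a = double (m a)" .
      moreover have "?m1 (2 ^ w + a) = double (m a) + (E + M)"
        using 1 by (simp add: packed_def M_def)
      ultimately show ?thesis using dM(1)[OF m[OF 1]] fresh by simp
    next
      case (2 t)
      define i j where "i = t div n" and "j = t mod n"
      have ij: "i < n" "j < n" "t = i * n + j" using entry[OF 2(1) i_def j_def] by auto
      have "a div (n * n) = 1" using 2 by (auto intro!: div_nat_eqI)
      moreover have "a div n = n + i" "a mod n = j" using 2 ij(1) by (simp_all add: i_def j_def)
      ultimately have "m0 a = B i j"
        using 2 ij by (simp add: m0_def init_config_def)
      also have "\<dots> = double_Suc (m t)" using B ij by simp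
      finally have "m0 a = double_Suc (m t)" .
      moreover have "?m1 (2 ^ w + a) = double_Suc (m t) + (E + M)"
        using 2 by (simp add: packed_def M_def)
      ultimately show ?thesis using dM(2)[OF m[OF 2(1)]] fresh by simp
    next
      case 3
      have "m0 a = 0" using 3 by (simp add: m0_def init_config_def)
      moreover have "?m1 (2 ^ w + a) = m (M + a)" using 3 by (simp add: packed_def M_def)
      moreover have "m (M + a) < E + M" using old a by (simp add: M_def)
      ultimately show ?thesis by (simp add: decode_cell_stale)
    qed
  qed
  have "runs w' (round_code P R) r m (length [Op Add 4 4 3] + ((16 * (n * n) + 3) +
      (length (reset_code R) + (5 * t + ((14 * (n * n) + 3) + length [Op Add 2 2 2])))))
    (\<lambda>r' m'. ready (E + M) r' \<and> r' 2 = 2 * k \<and> (\<forall>a<M. m' (M + a) < E + M + M) \<and>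
      (\<forall>i<n. \<forall>j<n. m' (i * n + j) = C i j + C i j div inf_code - 1))"
    unfolding round_code_def
  proof (rule runs_seq[where ?Q1.0 = Q1])
    have "eval_binop w' Add E M = E + M" using E(2) nM by (intro eval) simp
    then show "runs w' (\<lambda>_. [Op Add 4 4 3]) r m (length [Op Add 4 4 3]) Q1"
      using r by (intro runs_straight) (simp_all add: Q1_def ready_def del: eval_binop.simps One_nat_def)
  next
    fix r1 m1 assume Q1: "Q1 r1 m1"
    show "runs w' (for_code pack_body ;; (\<lambda>_. reset_code R) ;; compile P ;; for_code unpack_body ;;
        (\<lambda>_. [Op Add 2 2 2])) r1 m1 ((16 * (n * n) + 3) +
      (length (reset_code R) + (5 * t + ((14 * (n * n) + 3) + length [Op Add 2 2 2]))))
    (\<lambda>r' m'. ready (E + M) r' \<and> r' 2 = 2 * k \<and> (\<forall>a<M. m' (M + a) < E + M + M) \<and>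
      (\<forall>i<n. \<forall>j<n. m' (i * n + j) = C i j + C i j div inf_code - 1))"
    proof (rule runs_seq[where ?Q1.0 = Q2])
      have "runs w' (for_code pack_body) r1 m (16 * (n * n) + 3)
          (\<lambda>r' m'. agree r' r1 \<and> m' = packed (E + M) (n * n) m)"
        using Q1 m E(2) by (intro runs_pack) (auto simp: Q1_def)
      then show "runs w' (for_code pack_body) r1 m1 (16 * (n * n) + 3) Q2"
        using Q1 ready_agree by (auto simp: Q1_def Q2_def agree_def elim!: runs_mono)
    next
      fix r2 m2 assume Q2: "Q2 r2 m2"
      show "runs w' ((\<lambda>_. reset_code R) ;; compile P ;; for_code unpack_body ;;
          (\<lambda>_. [Op Add 2 2 2])) r2 m2
        (length (reset_code R) + (5 * t + ((14 * (n * n) + 3) + length [Op Add 2 2 2])))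
        (\<lambda>r' m'. ready (E + M) r' \<and> r' 2 = 2 * k \<and> (\<forall>a<M. m' (M + a) < E + M + M) \<and>
          (\<forall>i<n. \<forall>j<n. m' (i * n + j) = C i j + C i j div inf_code - 1))"
      proof (rule runs_seq[where ?Q1.0 = Q3])
        show "runs w' (\<lambda>_. reset_code R) r2 m2 (length (reset_code R)) Q3"
        proof (rule runs_straight)
          show "list_all straight (reset_code R)" by (simp add: reset_code_def list_all_iff)
          fix s assume s: "s = fold (exec_instr w') (reset_code R) \<lparr>pc = 0, regs = r2, mem = m2\<rparr>"
          have "eval_binop w' Add 0 n = n" using nM less_MM[of n] by (subst eval) auto
          then have s': "regs s = (\<lambda>a. if 16 \<le> a \<and> a < R + 16 then 0 else r2 a)(16 := n)" "mem s = ?m1"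
            using Q2 P(1) unfolding s reset_code_def fold_append comp_def fold_reset
            by (simp_all add: Q2_def ready_def del: eval_binop.simps)
          have "Q2 (regs s) (mem s)" unfolding s' using Q2 by (simp add: Q2_def ready_def)
          moreover have "simulates w (E + M) R ?r0 m0 (regs s) (mem s)"
            unfolding simulates_def
          proof (intro conjI)
            show "\<forall>a<2 ^ w. m0 a < 2 ^ w \<and> mem s (2 ^ w + a) < E + M + 2 ^ w \<and>
                m0 a = decode_cell w (E + M) (mem s (2 ^ w + a))"
              unfolding s' using m0 by blast
            show "\<forall>a<R. ?r0 a < 2 ^ w \<and> regs s (a + 16) = ?r0 a"
              using nM by (auto simp: s' M_def)
          qed (use Q2 in \<open>simp_all add: s' Q2_def ready_def M_def\<close>)
          ultimately show "Q3 (regs s) (mem s)" by (simp add: Q3_def)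
        qed
      next
        fix r3 m3 assume Q3: "Q3 r3 m3"
        show "runs w' (compile P ;; for_code unpack_body ;; (\<lambda>_. [Op Add 2 2 2])) r3 m3
          (5 * t + ((14 * (n * n) + 3) + length [Op Add 2 2 2]))
          (\<lambda>r' m'. ready (E + M) r' \<and> r' 2 = 2 * k \<and> (\<forall>a<M. m' (M + a) < E + M + M) \<and>
            (\<forall>i<n. \<forall>j<n. m' (i * n + j) = C i j + C i j div inf_code - 1))"
        proof (rule runs_seq[where ?Q1.0 = Q4])
          have "runs w' (compile P) r3 m3 (5 * t) (\<lambda>r'' m''.
              let s = (step w P ^^ t) \<lparr>pc = 0, regs = ?r0, mem = m0\<rparr>
              in simulates w (E + M) R (regs s) (mem s) r'' m'' \<and> preserved w r3 m3 r'' m'')"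
            using Q3 P(2) halted by (intro sim.runs_compile) (auto simp: Q3_def init)
          then show "runs w' (compile P) r3 m3 (5 * t) Q4"
          proof (rule runs_mono)
            fix r4 m4
            assume "let s = (step w P ^^ t) \<lparr>pc = 0, regs = ?r0, mem = m0\<rparr>
              in simulates w (E + M) R (regs s) (mem s) r4 m4 \<and> preserved w r3 m3 r4 m4"
            then have sim: "simulates w (E + M) R (regs s) (mem s) r4 m4" and pre: "preserved w r3 m3 r4 m4"
              by (simp_all add: Let_def s_def init)
            have "r4 a = r3 a" if "a < 16" "a \<noteq> 5" "a \<noteq> 6" for a
              using pre that by (simp add: preserved_def)
            then have "ready (E + M) r4 \<and> r4 2 = k"
              using Q3 by (simp add: Q3_def Q2_def ready_def)
            with sim show "Q4 r4 m4" by (simp add: Q4_def)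
          qed simp
        next
          fix r4 m4 assume Q4: "Q4 r4 m4"
          then have m4: "m4 (M + a) < E + M + M \<and> mem s a = decode_cell w (E + M) (m4 (M + a))"
            if "a < M" for a
            using that unfolding Q4_def simulates_def M_def[symmetric] by blast
          have ms: "decode_cell w (E + M) (m4 (i * n + j + M + n * n + n * n)) = C i j" if "i < n" "j < n" for i j
          proof -
            have "i * n + j < n * n"
              using that by (rule index_less)
            then have "decode_cell w (E + M) (m4 (M + (2 * n * n + i * n + j))) = mem s (2 * n * n + i * n + j)"
              using m4[of "2 * n * n + i * n + j"] nM by simp
            also have "\<dots> = C i j"
              using out that unfolding matrix_at_def s_def[symmetric] by blast
            also have "M + (2 * n * n + i * n + j) = i * n + j + M + n * n + n * n" by simp
            finally show ?thesis .
          qed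
          show "runs w' (for_code unpack_body ;; (\<lambda>_. [Op Add 2 2 2])) r4 m4
            ((14 * (n * n) + 3) + length [Op Add 2 2 2])
            (\<lambda>r' m'. ready (E + M) r' \<and> r' 2 = 2 * k \<and> (\<forall>a<M. m' (M + a) < E + M + M) \<and>
              (\<forall>i<n. \<forall>j<n. m' (i * n + j) = C i j + C i j div inf_code - 1))"
          proof (rule runs_seq[where ?Q1.0 = Q5])
            have "runs w' (for_code unpack_body) r4 m4 (14 * (n * n) + 3)
              (\<lambda>r' m'. agree r' r4 \<and> m' = (\<lambda>a. if a < n * n then unpack_cell (E + M) m4 a else m4 a))"
            proof (rule runs_unpack)
              fix t assume t: "t < n * n"
              have "m4 (t + M + n * n + n * n) < E + M + M"
                using m4[of "t + n * n + n * n"] t nM by (simp add: add_ac)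
              moreover have "decode_cell w (E + M) (m4 (t + M + n * n + n * n)) \<in> {1..inf_code}"
                using entry[OF t refl refl] ms[of "t div n" "t mod n"] C by simp
              ultimately show "m4 (t + M + n * n + n * n) < E + M + M \<and>
                decode_cell w (E + M) (m4 (t + M + n * n + n * n)) \<in> {1..inf_code}" ..
            qed (use Q4 E in \<open>auto simp: Q4_def\<close>)
            then show "runs w' (for_code unpack_body) r4 m4 (14 * (n * n) + 3) Q5"
            proof (rule runs_mono)
              fix r5 m5 assume a5: "agree r5 r4 \<and> m5 = (\<lambda>a. if a < n * n then unpack_cell (E + M) m4 a else m4 a)"
              have "m5 (i * n + j) = C i j + C i j div inf_code - 1" if "i < n" "j < n" for i j
              proof -
                have "i * n + j < n * n"
                  using that by (rule index_less)
                then show ?thesis using a5 ms[OF that] by (simp add: unpack_cell_def Let_def)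
              qed
              moreover have "m5 (M + a) < E + M + M" if "a < M" for a
                using a5 m4[OF that] nM by simp
              moreover have "ready (E + M) r5" "r5 2 = k"
                using a5 Q4 ready_agree by (auto simp: Q4_def agree_def)
              ultimately show "Q5 r5 m5" by (simp add: Q5_def)
            qed simp
          next
            fix r5 m5 assume Q5: "Q5 r5 m5"
            have "eval_binop w' Add k k = 2 * k" using r(3) by (subst eval) auto
            then show "runs w' (\<lambda>_. [Op Add 2 2 2]) r5 m5 (length [Op Add 2 2 2])
              (\<lambda>r' m'. ready (E + M) r' \<and> r' 2 = 2 * k \<and> (\<forall>a<M. m' (M + a) < E + M + M) \<and>
                (\<forall>i<n. \<forall>j<n. m' (i * n + j) = C i j + C i j div inf_code - 1))"
              using Q5 by (intro runs_straight) (simp_all add: Q5_def ready_def del: eval_binop.simps One_nat_def)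
          qed
        qed
      qed
    qed
  qed
  then show ?thesis
    by (rule runs_mono) (use t_le in \<open>auto simp: reset_code_def\<close>)
qed

end

section \<open>Correctness\<close>

definition truncated :: "(nat \<Rightarrow> nat) \<Rightarrow> nat \<Rightarrow> enat \<Rightarrow> int extended" where
  "truncated f m d = (case d of enat k \<Rightarrow> if k \<le> m then Fin (int (f k)) else Pinf | \<infinity> \<Rightarrow> Pinf)"

lemma truncated_simps [simp]:
  "truncated f m (enat k) = (if k \<le> m then Fin (int (f k)) else Pinf)"
  "truncated f m \<infinity> = Pinf"
  by (simp_all add: truncated_def)

lemma minmax_product_distance:
  assumes G: "pair_fin_digraph G" "pverts G = {..<n}" and uv: "u < n" "v < n"
  shows "minmax_product n (\<lambda>i j. truncated (\<lambda>k. 2 * k) m (distance G i j))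
      (\<lambda>i j. truncated (\<lambda>k. 2 * k + 1) m (distance G i j)) u v = truncated Suc (2 * m) (distance G u v)"
    (is "minmax_product n ?A ?B u v = ?C")
  unfolding minmax_product_def
proof (rule Min_eqI)
  show "finite ((\<lambda>z. max (?A u z) (?B z v)) ` {..<n})" by simp
next
  fix y assume "y \<in> (\<lambda>z. max (?A u z) (?B z v)) ` {..<n}"
  then obtain z where y: "y = max (?A u z) (?B z v)" by auto
  have tri: "distance G u v \<le> distance G u z + distance G z v"
    by (rule pair_fin_digraph.distance_triangle[OF G(1)])
  show "?C \<le> y"
  proof (cases "distance G u z")
    case (enat a)
    show ?thesis
    proof (cases "distance G z v")
      case (enat b)
      obtain k where k: "distance G u v = enat k" "k \<le> a + b"
        using tri \<open>distance G u z = enat a\<close> enat by (cases "distance G u v") auto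
      show ?thesis
        using k enat \<open>distance G u z = enat a\<close> unfolding y by (auto simp: max_def)
    qed (simp add: y max_def)
  qed (simp add: y max_def)
next
  show "?C \<in> (\<lambda>z. max (?A u z) (?B z v)) ` {..<n}"
  proof (cases "\<exists>k\<le>2 * m. distance G u v = enat k")
    case True
    then obtain k where k: "k \<le> 2 * m" "distance G u v = enat k" by auto
    \<comment> \<open>The larger half goes to the even factor: for \<open>k = 2 * h\<close> the
      maximum is \<open>2 * h + 1\<close>, for \<open>k = 2 * h + 1\<close> it is
      \<open>2 * h + 2\<close>.\<close>
    define a b where "a = k - k div 2" and "b = k div 2"
    have ab: "a + b = k" "a \<le> m" "b \<le> m" "max (2 * a) (2 * b + 1) = Suc k"
      using k(1) by (auto simp: a_def b_def max_def; presburger)+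
    obtain z where z: "z < n" "distance G u z \<le> enat a" "distance G z v \<le> enat b"
      using pair_fin_digraph.distance_split[OF G(1), of u v a b] G(2) k(2) ab(1) by auto
    obtain a' b' where a'b': "distance G u z = enat a'" "distance G z v = enat b'"
      using z by (cases "distance G u z"; cases "distance G z v") auto
    \<comment> \<open>The triangle inequality turns both upper bounds from the split into
      equalities.\<close>
    have "k \<le> a' + b'"
      using pair_fin_digraph.distance_triangle[OF G(1), of u v z] k(2) a'b' by simp
    then have "a' = a" "b' = b"
      using z a'b' ab(1) by auto
    then have "?C = max (?A u z) (?B z v)"
      using a'b' ab k by (auto simp: max_def split: if_splits)
    then show ?thesis by (rule image_eqI) (use z(1) in simp)
  next
    case False
    then have C: "?C = Pinf" by (cases "distance G u v") auto
    \<comment> \<open>The bound \<open>Pinf\<close> must also be attained. The middle vertex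
      \<open>u\<close> does it, since a finite maximum would put \<open>v\<close> within distance
      \<open>m\<close>.\<close>
    have Pinf: "max (?A u u) (?B u v) = Pinf"
    proof (rule ccontr)
      assume "max (?A u u) (?B u v) \<noteq> Pinf"
      then have "distance G u v \<le> enat m"
        by (cases "distance G u v") (auto simp: max_def split: if_splits)
      then show False using False by (cases "distance G u v") auto
    qed
    show ?thesis by (rule image_eqI[of _ _ u]) (use C Pinf uv(1) in simp_all)
  qed
qed

section \<open>A lower bound on the time of Min-Max programs\<close>

lemma mem_step_eq: "\<exists>b. \<forall>a. a \<noteq> b \<longrightarrow> mem (step w P s) a = mem s a"
proof (cases "halted P s")
  case False
  then show ?thesis by (cases "P ! pc s") (auto simp: step_def)
qed (simp add: step_def)

text \<open>One instruction writes at most one cell, so time bounds the number of altered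
  cells.\<close>

lemma card_changed_cells:
  "finite {a. mem ((step w P ^^ t) s) a \<noteq> mem s a} \<and> card {a. mem ((step w P ^^ t) s) a \<noteq> mem s a} \<le> t"
proof (induction t)
  case (Suc t)
  let ?D = "\<lambda>t. {a. mem ((step w P ^^ t) s) a \<noteq> mem s a}"
  obtain b where "\<forall>a. a \<noteq> b \<longrightarrow> mem ((step w P ^^ Suc t) s) a = mem ((step w P ^^ t) s) a"
    using mem_step_eq[of w P "(step w P ^^ t) s"] by auto
  then have sub: "?D (Suc t) \<subseteq> insert b (?D t)" by force
  have "card (?D (Suc t)) \<le> card (insert b (?D t))"
    using sub Suc by (intro card_mono) auto
  also have "\<dots> \<le> Suc (card (?D t))" by (rule card_insert_le_m1) auto
  finally show ?case using Suc finite_subset[OF sub] by auto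
qed simp

lemma halts_within_matrix_ge:
  assumes halts: "halts_within w P \<tau> s (matrix_at n b X)"
    and new: "\<And>i j. i < n \<Longrightarrow> j < n \<Longrightarrow> X i j \<noteq> mem s (b + i * n + j)"
  shows "real (n * n) \<le> \<tau>"
proof -
  obtain t where t: "real t \<le> \<tau>" and X: "matrix_at n b X ((step w P ^^ t) s)"
    using halts unfolding halts_within_def by blast
  have "{b..<b + n * n} \<subseteq> {a. mem ((step w P ^^ t) s) a \<noteq> mem s a}"
  proof
    fix a assume a: "a \<in> {b..<b + n * n}"
    define i j where "i = (a - b) div n" and "j = (a - b) mod n"
    have "0 < n" using a by (cases n) auto
    then have ij: "i < n" "j < n" "a = b + i * n + j"
      using a by (auto simp: i_def j_def less_mult_imp_div_less)
    then show "a \<in> {a. mem ((step w P ^^ t) s) a \<noteq> mem s a}"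
      using X new unfolding matrix_at_def by auto
  qed
  then have "card {b..<b + n * n} \<le> t"
    using card_changed_cells[where w = w and P = P and t = t and s = s] by (meson card_mono le_trans)
  then have "n * n \<le> t" by simp
  then have "real (n * n) \<le> real t" by (simp only: of_nat_le_iff)
  with t show ?thesis by linarith
qed

context reduction
begin

lemma minmax_time_ge:
  assumes halts: "\<And>A B. \<forall>i<n. \<forall>j<n. valid_entry w (A i j) \<and> valid_entry w (B i j) \<Longrightarrow>
      halts_within w P \<tau> (init_config n [\<lambda>i j. encode_entry w (A i j), \<lambda>i j. encode_entry w (B i j)])
          (matrix_at n (2 * n * n) (\<lambda>i j. encode_entry w (minmax_product n A B i j)))"
  shows "real (n * n) \<le> \<tau>"
proof -
  let ?A = "\<lambda>_ _ :: nat. Fin 1 :: int extended"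
  \<comment> \<open>For \<open>w = 2\<close> the word 1 would already be the code of infinity;
    \<open>3 \<le> w\<close> makes it a finite entry.\<close>
  have "(2::int) ^ 2 \<le> 2 ^ (w - 1)"
    using w_ge by (intro power_increasing) auto
  then have "valid_entry w (Fin 1)" by (simp add: valid_entry_def)
  then show ?thesis
  proof (intro halts_within_matrix_ge[OF halts[of ?A ?A]])
    fix i j assume ij: "i < n" "j < n"
    then have "(\<lambda>k. max (?A i k) (?A k j)) ` {..<n} = {Fin 1}" by auto
    then have "minmax_product n ?A ?A i j = Fin 1" by (simp add: minmax_product_def)
    moreover have "take_bit w (1::int) = 1" using w_ge by simp
    ultimately show "encode_entry w (minmax_product n ?A ?A i j) \<noteq>
        mem (init_config n [\<lambda>i j. encode_entry w (?A i j), \<lambda>i j. encode_entry w (?A i j)]) (2 * n * n + i * n + j)"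
      by (simp add: encode_entry_def init_config_def)
  qed auto
qed

text \<open>The word-level counterpart of \<open>truncated\<close>, so that memory contents are
  described by distances alone.\<close>

definition stored :: "(nat \<Rightarrow> nat) \<Rightarrow> nat \<Rightarrow> enat \<Rightarrow> nat" where
  "stored f m d = (case d of enat k \<Rightarrow> if k \<le> m then f k else inf_code | \<infinity> \<Rightarrow> inf_code)"

lemma encode_truncated:
  assumes "\<And>k. d = enat k \<Longrightarrow> f k < inf_code"
  shows "encode_entry w (truncated f m d) = stored f m d" "valid_entry w (truncated f m d)"
proof -
  have "encode_entry w Pinf = inf_code" by (simp add: encode_entry_def inf_code_eq)
  moreover have "encode_entry w (Fin (int a)) = a" "valid_entry w (Fin (int a))" if "a < inf_code" for a
  proof -
    have "a < 2 ^ w" using that inf_code_less by (simp add: M_def)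
    then have "take_bit w (int a) = int a"
      by (simp add: take_bit_int_eq_self)
    then show "encode_entry w (Fin (int a)) = a" by (simp add: encode_entry_def)
    have "int a < int (2 ^ (w - 1) - 1)" using that unfolding inf_code_eq by linarith
    then show "valid_entry w (Fin (int a))" by (simp add: valid_entry_def of_nat_diff)
  qed
  moreover have "valid_entry w Pinf" by (simp add: valid_entry_def)
  ultimately show "encode_entry w (truncated f m d) = stored f m d" "valid_entry w (truncated f m d)"
    using assms by (cases d; simp add: stored_def)+
qed

end

text \<open>Bracketed like the sequential composition in \<open>apsp_code\<close>, so that
  \<open>runs_seq\<close> produces it literally.\<close>

definition apsp_time :: "nat \<Rightarrow> nat \<Rightarrow> nat \<Rightarrow> nat" where
  "apsp_time n R \<tau> = (4 * ceillog2 (n + 2) + 17) + ((13 * (n * n) + 3) +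
     ((ceillog2 n * ((30 * (n * n) + R + 9 + 5 * \<tau>) + 2) + 2) + (10 * (n * n) + 3)))"

section \<open>Correctness of the complete program\<close>

context reduction
begin

text \<open>Finite distances are below \<open>n\<close>, so they and their successors stay below
  \<open>inf_code\<close>, and the quotient by \<open>inf_code\<close> detects exactly
  infinity.\<close>

lemma stored_simps:
  assumes "d = \<infinity> \<or> d < enat n"
  shows "double (stored id m d) = stored (\<lambda>k. 2 * k) m d"
    and "double_Suc (stored id m d) = stored (\<lambda>k. 2 * k + 1) m d"
    and "stored Suc m d + stored Suc m d div inf_code - 1 = stored id m d"
    and "n \<le> m \<Longrightarrow> output_cell (stored id m d) = encode_distance w' d"
    and "stored id m d \<le> inf_code"
    and "stored Suc m d \<in> {1..inf_code}"
proof -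
  consider "d = \<infinity>" | k where "d = enat k" "k < n"
    using assms by (cases d) auto
  note cases = this
  have inf: "inf_code div inf_code = 1" "1 < inf_code" using inf_code_ge by auto
  have less: "x < inf_code \<and> x div inf_code = 0 \<and> x \<noteq> inf_code" if "x < n + 2" for x
    using that inf_code_ge by auto
  show "double (stored id m d) = stored (\<lambda>k. 2 * k) m d"
    by (rule cases) (auto simp: stored_def double_def inf less)
  show "double_Suc (stored id m d) = stored (\<lambda>k. 2 * k + 1) m d"
    by (rule cases) (auto simp: stored_def double_Suc_def double_def inf less)
  show "stored Suc m d + stored Suc m d div inf_code - 1 = stored id m d"
    by (rule cases) (auto simp: stored_def inf less)
  show "output_cell (stored id m d) = encode_distance w' d" if "n \<le> m"
    by (rule cases) (use that less in \<open>auto simp: stored_def output_cell_def encode_distance_def\<close>)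
  show "stored id m d \<le> inf_code"
    by (rule cases) (auto simp: stored_def less less_imp_le)
  show "stored Suc m d \<in> {1..inf_code}"
    using inf(2) by (auto intro: cases simp: stored_def less less_imp_le Suc_leI split: enat.splits)
qed

lemma runs_apsp:
  assumes G: "pair_fin_digraph G" "pverts G = {..<n}"
    and P: "0 < R" "\<forall>i\<in>set P. instr_regs i \<subseteq> {..<R}"
    and halts: "\<And>A B. \<forall>i<n. \<forall>j<n. valid_entry w (A i j) \<and> valid_entry w (B i j) \<Longrightarrow>
      halts_within w P \<tau> (init_config n [\<lambda>i j. encode_entry w (A i j), \<lambda>i j. encode_entry w (B i j)])
          (matrix_at n (2 * n * n) (\<lambda>i j. encode_entry w (minmax_product n A B i j)))"
    and r: "r 0 = n"
    and m: "m = mem (init_config n [\<lambda>u v. of_bool ((u, v) \<in> parcs G)])"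
  shows "runs w' (apsp_code c P R) r m (apsp_time n R (nat \<lfloor>\<tau>\<rfloor>)) (\<lambda>r' m'.
    \<forall>i<n. \<forall>j<n. m' (n * n + i * n + j) = encode_distance w' (distance G i j))"
proof -
  have nM: "12 * n + 8 \<le> M" "3 * (n * n) < M" by (rule M_bounds)+
  have near: "distance G u v = \<infinity> \<or> distance G u v < enat n" for u v
    using pair_fin_digraph.distance_less_card[OF G(1)] G(2) by (cases "distance G u v") auto
  have entry_less: "2 * k + 1 < inf_code" "2 * k < inf_code" "Suc k < inf_code" if "distance G u v = enat k" for u v k
  proof -
    have "k < n" using near[of u v] that by simp
    then show "2 * k + 1 < inf_code" "2 * k < inf_code" "Suc k < inf_code"
      using inf_code_ge by linarith+
  qed
  define F where "F i m' \<longleftrightarrow> (\<forall>u<n. \<forall>v<n. m' (u * n + v) = stored id (2 ^ i) (distance G u v))"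
    for i :: nat and m' :: "nat \<Rightarrow> nat"
  \<comment> \<open>After \<open>i\<close> rounds the epoch is \<open>M * i\<close> and distances up
    to \<open>2 ^ i\<close> are known. For \<open>i = 0\<close> this is the adjacency matrix with
    zero diagonal.\<close>
  define I where "I i r' m' \<longleftrightarrow> ready (M * i) r' \<and> r' 2 = 2 ^ i \<and> (\<forall>a<M. m' (M + a) < M * i + M) \<and> F i m'"
    for i :: nat and r' m' :: "nat \<Rightarrow> nat"
  have entry: "t div n < n \<and> t mod n < n \<and> t div n * n + t mod n = t" if "t < n * n" for t
    using that by (cases "n = 0") (auto simp: less_mult_imp_div_less)
  have F_le: "m' t \<le> inf_code" if "F i m'" "t < n * n" for i m' t
  proof -
    have "m' t = stored id (2 ^ i) (distance G (t div n) (t mod n))"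
      using that entry[OF that(2)] unfolding F_def by metis
    then show ?thesis
      using stored_simps(5)[OF near] by simp
  qed
  let ?N = "ceillog2 n"
  have "runs w' (apsp_code c P R) r m ((4 * ceillog2 (n + 2) + 17) + ((13 * (n * n) + 3) +
     ((?N * ((30 * (n * n) + R + 9 + 5 * nat \<lfloor>\<tau>\<rfloor>) + 2) + 2) + (10 * (n * n) + 3))))
    (\<lambda>r' m'. \<forall>i<n. \<forall>j<n. m' (n * n + i * n + j) = encode_distance w' (distance G i j))"
    unfolding apsp_code_def
  proof (rule runs_seq[OF runs_prologue[of r m, OF r]], elim conjE)
    fix r1 m1 assume r1: "ready 0 r1" "r1 2 = 1" "m1 = m"
    have m_bit: "m t = of_bool ((t div n, t mod n) \<in> parcs G)" if "t < n * n" for t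
      using that entry[OF that] by (simp add: m init_config_def)
    show "runs w' (for_code init_body ;; while_code 2 0 (round_code P R) ;; for_code output_body) r1 m1
      ((13 * (n * n) + 3) + ((?N * ((30 * (n * n) + R + 9 + 5 * nat \<lfloor>\<tau>\<rfloor>) + 2) + 2) + (10 * (n * n) + 3)))
      (\<lambda>r' m'. \<forall>i<n. \<forall>j<n. m' (n * n + i * n + j) = encode_distance w' (distance G i j))"
      unfolding r1(3)
    proof (rule runs_seq[OF runs_init[OF r1(1)]], goal_cases)
      case (1 t)
      then show ?case using m_bit by simp
    next
      case (2 r2 m2)
      then have r2: "agree r2 r1" and m2: "m2 = (\<lambda>a. if a < n * n then init_cell m a else m a)" by auto
      have I0: "I 0 r2 m2"
      proof -
        have "m2 (u * n + v) = stored id 1 (distance G u v)" if uv: "u < n" "v < n" for u v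
        proof -
          have less: "u * n + v < n * n" using uv by (rule index_less)
          have "m2 (u * n + v) = (if u = v then 0 else if (u, v) \<in> parcs G then 1 else inf_code)"
            using less uv m_bit[OF less] by (simp add: m2 init_cell_def)
          moreover have "distance G u v = 0 \<longleftrightarrow> u = v"
            using pair_fin_digraph.distance_eq_0_iff[OF G(1)] G(2) uv by simp
          moreover have "distance G u v \<le> enat 1 \<longleftrightarrow> u = v \<or> (u, v) \<in> parcs G"
            using pair_fin_digraph.distance_le_1_iff[OF G(1)] G(2) uv by simp
          ultimately show ?thesis
            by (cases "distance G u v") (auto simp: stored_def zero_enat_def le_Suc_eq)
        qed
        moreover have "m2 (M + a) = 0" for a
          using nM by (simp add: m2 m init_config_def)
        ultimately show ?thesis
          using r1 r2 ready_agree[OF r2] nM by (simp add: I_def F_def agree_def)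
      qed
      show ?case
      proof (rule runs_seq[where ?Q1.0 = "I ?N"])
        show "runs w' (while_code 2 0 (round_code P R)) r2 m2
          (?N * ((30 * (n * n) + R + 9 + 5 * nat \<lfloor>\<tau>\<rfloor>) + 2) + 2) (I ?N)"
        proof (rule runs_while[where I = I])
          show "I 0 r2 m2" by (rule I0)
        next
          fix i r3 m3 assume i: "i < ?N" and I: "I i r3 m3"
          have less: "2 ^ i < n" using i by (cases "n = 0") (auto intro: less_ceillog2)
          \<comment> \<open>From \<open>2 ^ i < n\<close> the round number is at most
            \<open>n\<close>, and \<open>n + 3 \<le> M\<close> keeps the epochs within wide
            words.\<close>
          have "i \<le> n" using less less_exp[of i] by linarith
          then have "M * (i + 3) \<le> M * (n + 3)" by (intro mult_le_mono2) simp
          also have "\<dots> \<le> M * M" using nM by (intro mult_le_mono2) simp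
          finally have E: "M * i + 3 * M \<le> M * M" by (simp add: algebra_simps)
          have k: "2 * 2 ^ i < M * M" using less nM less_MM[of "2 * 2 ^ i"] by linarith
          let ?A = "\<lambda>u v. truncated (\<lambda>k. 2 * k) (2 ^ i) (distance G u v)"
          let ?B = "\<lambda>u v. truncated (\<lambda>k. 2 * k + 1) (2 ^ i) (distance G u v)"
          let ?C = "\<lambda>u v. encode_entry w (minmax_product n ?A ?B u v)"
          have C: "?C u v = stored Suc (2 * 2 ^ i) (distance G u v)" if "u < n" "v < n" for u v
            unfolding minmax_product_distance[OF G that]
            by (rule encode_truncated(1)) (erule entry_less)
          have A: "encode_entry w (?A u v) = stored (\<lambda>k. 2 * k) (2 ^ i) (distance G u v)"
            "valid_entry w (?A u v)" for u v
            by (rule encode_truncated(1), erule entry_less) (rule encode_truncated(2), erule entry_less)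
          have B: "encode_entry w (?B u v) = stored (\<lambda>k. 2 * k + 1) (2 ^ i) (distance G u v)"
            "valid_entry w (?B u v)" for u v
            by (rule encode_truncated(1), erule entry_less) (rule encode_truncated(2), erule entry_less)
          have "runs w' (round_code P R) r3 m3 (30 * (n * n) + R + 9 + 5 * nat \<lfloor>\<tau>\<rfloor>) (\<lambda>r' m'.
            ready (M * i + M) r' \<and> r' 2 = 2 * 2 ^ i \<and> (\<forall>a<M. m' (M + a) < M * i + M + M) \<and>
            (\<forall>u<n. \<forall>v<n. m' (u * n + v) = ?C u v + ?C u v div inf_code - 1))"
          proof (rule runs_round[OF P, where e = i])
            show "halts_within w P \<tau> (init_config n [\<lambda>u v. encode_entry w (?A u v), \<lambda>u v. encode_entry w (?B u v)])
              (matrix_at n (2 * n * n) ?C)"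
              by (rule halts) (use A B in blast)
            show "m3 t \<le> inf_code" if "t < n * n" for t
              using F_le that I by (auto simp: I_def)
            fix u v assume uv: "u < n" "v < n"
            have m3: "m3 (u * n + v) = stored id (2 ^ i) (distance G u v)"
              using I uv by (simp add: I_def F_def)
            show "encode_entry w (?A u v) = double (m3 (u * n + v))"
              "encode_entry w (?B u v) = double_Suc (m3 (u * n + v))"
              unfolding m3 A B by (rule stored_simps(1,2)[OF near, symmetric])+
            show "?C u v \<in> {1..inf_code}"
              unfolding C[OF uv] by (rule stored_simps(6)[OF near])
          qed (use I E k in \<open>auto simp: I_def\<close>)
          then have "runs w' (round_code P R) r3 m3 (30 * (n * n) + R + 9 + 5 * nat \<lfloor>\<tau>\<rfloor>) (I (Suc i))"
          proof (rule runs_mono)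
            fix r4 m4 assume r4: "ready (M * i + M) r4 \<and> r4 2 = 2 * 2 ^ i \<and> (\<forall>a<M. m4 (M + a) < M * i + M + M) \<and>
              (\<forall>u<n. \<forall>v<n. m4 (u * n + v) = ?C u v + ?C u v div inf_code - 1)"
            have "m4 (u * n + v) = stored id (2 ^ Suc i) (distance G u v)" if uv: "u < n" "v < n" for u v
            proof -
              have "m4 (u * n + v) = ?C u v + ?C u v div inf_code - 1" using r4 uv by blast
              then show ?thesis
                unfolding C[OF uv] stored_simps(3)[OF near] by simp
            qed
            then show "I (Suc i) r4 m4"
              using r4 by (simp add: I_def F_def add.commute)
          qed simp
          then show "r3 2 < r3 0 \<and> runs w' (round_code P R) r3 m3 (30 * (n * n) + R + 9 + 5 * nat \<lfloor>\<tau>\<rfloor>) (I (Suc i))"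
            using I less by (simp add: I_def ready_def)
        next
          fix r3 m3 :: "nat \<Rightarrow> nat" assume "I ?N r3 m3"
          then show "\<not> r3 2 < r3 0"
            using le_two_power_ceillog2[of n] by (simp add: I_def ready_def)
        qed
      next
        fix r3 m3 :: "nat \<Rightarrow> nat" assume I: "I ?N r3 m3"
        have "runs w' (for_code output_body) r3 m3 (10 * (n * n) + 3)
            (\<lambda>r' m'. \<forall>t < n * n. m' (n * n + t) = output_cell (m3 t))"
          by (rule runs_output) (use I F_le in \<open>auto simp: I_def\<close>)
        then show "runs w' (for_code output_body) r3 m3 (10 * (n * n) + 3)
            (\<lambda>r' m'. \<forall>i<n. \<forall>j<n. m' (n * n + i * n + j) = encode_distance w' (distance G i j))"
        proof (rule runs_mono)
          fix r4 m4 :: "nat \<Rightarrow> nat" assume m4: "\<forall>t < n * n. m4 (n * n + t) = output_cell (m3 t)"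
          have "m4 (n * n + u * n + v) = encode_distance w' (distance G u v)" if uv: "u < n" "v < n" for u v
          proof -
            have "m4 (n * n + u * n + v) = output_cell (m3 (u * n + v))"
              using m4 index_less[OF uv] by (simp add: add.assoc)
            also have "m3 (u * n + v) = stored id (2 ^ ?N) (distance G u v)"
              using I uv by (simp add: I_def F_def)
            also have "output_cell \<dots> = encode_distance w' (distance G u v)"
              by (rule stored_simps(4)[OF near le_two_power_ceillog2])
            finally show ?thesis .
          qed
          then show "\<forall>i<n. \<forall>j<n. m4 (n * n + i * n + j) = encode_distance w' (distance G i j)" by blast
        qed simp
      qed
    qed
  qed
  then show ?thesis by (simp only: apsp_time_def)
qed

end

section \<open>Running time\<close>

text \<open>For \<open>2 \<le> n\<close> the logarithm \<open>l\<close> is at least 1 and absorbs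
  roundings, as in \<open>n + 2 \<le> 2 * n\<close>; likewise \<open>\<tau>\<close> is at least 1
  and absorbs the quadratic and constant costs.\<close>

lemma apsp_time_le:
  assumes n: "2 \<le> n" and \<tau>: "real (n * n) \<le> \<tau>"
  shows "real (apsp_time n R (nat \<lfloor>\<tau>\<rfloor>)) \<le> real (200 + 2 * R) * (\<tau> * log 2 (real n))"
proof -
  define l where "l = log 2 (real n)"
  have l: "1 \<le> l" using n by (simp add: l_def)
  have "real (ceillog2 n) < l + 1" unfolding l_def using n by (intro ceillog2_less_log) simp
  then have N: "real (ceillog2 n) \<le> 2 * l" using l by linarith
  have "ceillog2 (n + 2) \<le> ceillog2 (2 * n)" using n by (intro ceillog2_mono) simp
  also have "\<dots> = Suc (ceillog2 n)" using n by (intro ceillog2_rec_even) simp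
  finally have N2: "real (ceillog2 (n + 2)) \<le> 3 * l" using N l by linarith
  have "4 \<le> n * n" using mult_le_mono[OF n n] by simp
  then have "real 4 \<le> real (n * n)" by (simp only: of_nat_le_iff)
  with \<tau> have \<tau>1: "1 \<le> \<tau>" by simp
  have fl: "real (nat \<lfloor>\<tau>\<rfloor>) \<le> \<tau>" using \<tau>1 by simp
  have l\<tau>: "l \<le> \<tau> * l" "\<tau> \<le> \<tau> * l" "1 \<le> \<tau> * l" using \<tau>1 l mult_mono[of 1 \<tau> 1 l] by auto
  have "real R \<le> real R * \<tau>" using \<tau>1 mult_left_mono[of 1 \<tau> "real R"] by simp
  moreover have "(46 + real R) * \<tau> = 46 * \<tau> + real R * \<tau>" by (rule distrib_right)
  \<comment> \<open>46 is 30 + 11 + 5, with each term charged to \<open>\<tau>\<close>.\<close>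
  ultimately have "30 * real (n * n) + real R + 11 + 5 * real (nat \<lfloor>\<tau>\<rfloor>) \<le> (46 + real R) * \<tau>"
    using \<tau> fl \<tau>1 by linarith
  then have "real (ceillog2 n) * (30 * real (n * n) + real R + 11 + 5 * real (nat \<lfloor>\<tau>\<rfloor>)) \<le>
      (2 * l) * ((46 + real R) * \<tau>)"
    using N l by (intro mult_mono) auto
  moreover have "real (apsp_time n R (nat \<lfloor>\<tau>\<rfloor>)) = 4 * real (ceillog2 (n + 2)) + 25 + 23 * real (n * n) +
      real (ceillog2 n) * (30 * real (n * n) + real R + 11 + 5 * real (nat \<lfloor>\<tau>\<rfloor>))"
    by (simp add: apsp_time_def algebra_simps)
  ultimately have "real (apsp_time n R (nat \<lfloor>\<tau>\<rfloor>)) \<le> 12 * l + 25 + 23 * \<tau> + (2 * l) * ((46 + real R) * \<tau>)"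
    using N2 \<tau> by linarith
  also have "(2 * l) * ((46 + real R) * \<tau>) = real (92 + 2 * R) * (\<tau> * l)"
    by (simp add: algebra_simps)
  \<comment> \<open>60 is 12 + 25 + 23. Together with 92 this gives 152, rounded up to 200
    below.\<close>
  also have "12 * l + 25 + 23 * \<tau> + real (92 + 2 * R) * (\<tau> * l) \<le> 60 * (\<tau> * l) + real (92 + 2 * R) * (\<tau> * l)"
    using l\<tau> by linarith
  also have "\<dots> = real (152 + 2 * R) * (\<tau> * l)" by (simp add: algebra_simps)
  also have "\<dots> \<le> real (200 + 2 * R) * (\<tau> * l)"
    using l\<tau>(3) by (intro mult_right_mono) auto
  finally show ?thesis by (simp add: l_def)
qed

theorem theorem6:
  fixes T :: "nat \<Rightarrow> real"
  assumes "minmax_computable_in_time T"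
  shows "\<exists>T'. unweighted_apsp_solvable_in_time T' \<and> T' \<in> O(\<lambda>n. T n * log 2 (real n))"
proof -
  obtain c P where c: "3 \<le> c" and P: "\<And>n A B. let w = word_length c n in
        (\<forall>i<n. \<forall>j<n. valid_entry w (A i j) \<and> valid_entry w (B i j)) \<longrightarrow>
        halts_within w P (T n)
          (init_config n [\<lambda>i j. encode_entry w (A i j), \<lambda>i j. encode_entry w (B i j)])
          (matrix_at n (2 * n * n) (\<lambda>i j. encode_entry w (minmax_product n A B i j)))"
    using assms unfolding minmax_computable_in_time_def by blast
  obtain R where R: "0 < R" "\<forall>i\<in>set P. instr_regs i \<subseteq> {..<R}"
    using instr_regs_bound by blast
  interpret reduction n c for n by unfold_locales (rule c)
  have halts: "halts_within (w n) P (T n)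
      (init_config n [\<lambda>i j. encode_entry (w n) (A i j), \<lambda>i j. encode_entry (w n) (B i j)])
      (matrix_at n (2 * n * n) (\<lambda>i j. encode_entry (w n) (minmax_product n A B i j)))"
    if "\<forall>i<n. \<forall>j<n. valid_entry (w n) (A i j) \<and> valid_entry (w n) (B i j)" for n A B
    using P[of n A B] that unfolding w_def Let_def by blast
  define T' where "T' n = real (apsp_time n R (nat \<lfloor>T n\<rfloor>))" for n
  \<comment> \<open>One program for all \<open>n\<close>: it depends only on \<open>c\<close>,
    \<open>P\<close> and \<open>R\<close>, and is placed at position 0 with nothing around
    it.\<close>
  define P' where "P' = apsp_code c P R 0"
  have "unweighted_apsp_solvable_in_time T'"
    unfolding unweighted_apsp_solvable_in_time_def Let_def
  \<comment> \<open>Doubling \<open>c\<close> doubles the word length for every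
    \<open>n\<close>.\<close>
  proof (intro exI[of _ "2 * c"] conjI exI[of _ P'] allI impI)
    show "3 \<le> 2 * c" using c by simp
    fix n and G :: "nat pair_pre_digraph"
    assume "pair_fin_digraph G \<and> pverts G = {..<n}"
    then have G: "pair_fin_digraph G" "pverts G = {..<n}" by auto
    let ?s = "init_config n [\<lambda>u v. of_bool ((u, v) \<in> parcs G)]"
    have s: "\<lparr>pc = 0, regs = regs ?s, mem = mem ?s\<rparr> = ?s" by (simp add: init_config_def)
    have "runs (w' n) (apsp_code c P R) (regs ?s) (mem ?s) (apsp_time n R (nat \<lfloor>T n\<rfloor>)) (\<lambda>r' m'.
      \<forall>i<n. \<forall>j<n. m' (n * n + i * n + j) = encode_distance (w' n) (distance G i j))"
      by (rule runs_apsp[OF G R halts]) (simp_all add: init_config_def)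
    then obtain t r' m' where t: "t \<le> apsp_time n R (nat \<lfloor>T n\<rfloor>)"
      "(step (w' n) P' ^^ t) ?s = \<lparr>pc = length P', regs = r', mem = m'\<rparr>"
      "\<forall>i<n. \<forall>j<n. m' (n * n + i * n + j) = encode_distance (w' n) (distance G i j)"
      unfolding runs_def P'_def by (auto simp: s dest!: spec[of _ "[]"])
    show "halts_within (word_length (2 * c) n) P' (T' n) ?s
      (matrix_at n (n * n) (\<lambda>u v. encode_distance (word_length (2 * c) n) (distance G u v)))"
      unfolding halts_within_def w'_def[symmetric]
      by (intro exI[of _ t] exI) (use t in \<open>auto simp: T'_def halted_def matrix_at_def\<close>)
  qed
  moreover have "T' \<in> O(\<lambda>n. T n * log 2 (real n))"
  proof (rule bigoI)
    show "\<forall>\<^sub>F n in at_top. norm (T' n) \<le> real (200 + 2 * R) * norm (T n * log 2 (real n))"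
    \<comment> \<open>At \<open>n = 1\<close> the logarithm is 0 while the program still takes time,
      so the bound starts at 2.\<close>
    proof (rule eventually_at_top_linorderI[of 2])
      fix n :: nat assume n: "2 \<le> n"
      have T: "real (n * n) \<le> T n"
        by (rule minmax_time_ge) (rule halts)
      have "0 \<le> T n * log 2 (real n)"
        using T n by (intro mult_nonneg_nonneg) (simp_all add: order_trans[OF _ T])
      then show "norm (T' n) \<le> real (200 + 2 * R) * norm (T n * log 2 (real n))"
        using apsp_time_le[OF n T, of R] by (simp add: T'_def)
    qed
  qed
  ultimately show ?thesis by blast
qed

end
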